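(* Let $d\in\mathbb{N}$, $N\ge2$, and suppose the Assumption below holds with constants $C_d>0$, $p_d>0$. Then the cubature rule $Q_{d,N}$ defined below uses at most $N$ integration nodes and satisfies $$e^{\mathrm{wor}}(Q_{d,N};H_d)^2\le 2^{(p_d+2)(p_d+1)}(1+p_d)\Big(1+\frac{1}{p_d}\Big)^{p_d}\,C_d\,\frac{1}{N^{p_d+1}}.$$
   Context: Setting. $H_d$ is a separable, infinite-dimensional reproducing kernel Hilbert space of real-valued functions on $[0,1]^d$ with real reproducing kernel $K$ such that $M_{2,d}:=\int_{[0,1]^d}K(\mathbf{x},\mathbf{x})\,d\mathbf{x}<\infty$ and the embedding $H_d\hookrightarrow L_2([0,1]^d)$ is compact. The operator $W_d f=\int_{[0,1]^d}f(\mathbf{y})K(\cdot,\mathbf{y})\,d\mathbf{y}$ has eigenpairs $(\lambda_{d,j},\eta_{d,j})_{j\in\mathbb{N}}$ with $\lambda_{d,1}\ge\lambda_{d,2}\ge\cdots>0$ and $(\eta_{d,j})$ an orthonormal basis of $H_d$, orthogonal in $L_2$ with $\|\eta_{d,j}\|_{L_2}^2=\lambda_{d,j}$; put $\xi_{d,j}:=\eta_{d,j}/\sqrt{\lambda_{d,j}}$ and $u_m:=\frac1m\sum_{j=1}^m\xi_{d,j}^2$. $B_d\supset H_d$ is a separable Banach space of real functions on $[0,1]^d$, continuously embedded in $L_2([0,1]^d)$, with a zero-mean Gaussian measure $\mu_d$ satisfying $K(\mathbf{x},\mathbf{y})=\int_{B_d}f(\mathbf{x})f(\mathbf{y})\,d\mu_d(f)$.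 For $A\colon B_d\to L_2$, $e^{\mathrm{avg}}(A;\widetilde{\mathrm{App}}_d):=\big(\int_{B_d}\|f-Af\|_{L_2}^2d\mu_d(f)\big)^{1/2}$; for a cubature rule $Q$, $e^{\mathrm{avg}}(Q;\widetilde{\mathrm{Int}}_d):=\big(\int_{B_d}|\int_{[0,1]^d}f-Qf|^2d\mu_d(f)\big)^{1/2}$ and $e^{\mathrm{wor}}(Q;H_d):=\sup_{\|f\|_{H_d}\le1}|\int_{[0,1]^d}f-Qf|$. Also $e_{\mathrm{avg}}(m;\widetilde{\mathrm{App}}_d,\Lambda^{\mathrm{all}})^2:=\sum_{j>m}\lambda_{d,j}$. Assumption: $\sum_{j=m+1}^\infty\lambda_{d,j}\le C_d(m+1)^{-p_d}$ for all $m\in\mathbb{N}_0$. Building blocks. (i) For $m,q\in\mathbb{N}$, an algorithm $A_{d,s}$ using $s$ function values and points $\mathcal{P}=\{\mathbf{t}^{(1)},\ldots,\mathbf{t}^{(q)}\}$: $A_{d,s+q}(f;\mathcal{P},A_{d,s},m):=\sum_{j=1}^m\big(\langle A_{d,s}f,\xi_{d,j}\rangle_{L_2}+\frac1q\sum_{\ell=1}^q[f(\mathbf{t}^{(\ell)})-(A_{d,s}f)(\mathbf{t}^{(\ell)})]\frac{\xi_{d,j}(\mathbf{t}^{(\ell)})}{u_m(\mathbf{t}^{(\ell)})}\big)\xi_{d,j}$ ($0/0:=0$); for all such data there is a $q$-point $\mathcal{P}$ with $e^{\mathrm{avg}}(A_{d,s+q};\widetilde{\mathrm{App}}_d)^2\le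 e_{\mathrm{avg}}(m;\widetilde{\mathrm{App}}_d,\Lambda^{\mathrm{all}})^2+\frac mq e^{\mathrm{avg}}(A_{d,s};\widetilde{\mathrm{App}}_d)^2$. (ii) For an algorithm $A_{d,n}$ using $n$ function values and $\mathcal{P}=\{\mathbf{t}^{(1)},\ldots,\mathbf{t}^{(r)}\}$: $Q_{d,n+r}(f;\mathcal{P},A_{d,n}):=\int_{[0,1]^d}(A_{d,n}f)(\mathbf{x})d\mathbf{x}+\frac1r\sum_{\ell=1}^r\big(f(\mathbf{t}^{(\ell)})-(A_{d,n}f)(\mathbf{t}^{(\ell)})\big)$; for all such data there is an $r$-point $\mathcal{P}$ with $e^{\mathrm{avg}}(Q_{d,n+r};\widetilde{\mathrm{Int}}_d)^2\le\frac1r e^{\mathrm{avg}}(A_{d,n};\widetilde{\mathrm{App}}_d)^2$. Construction. Write $p=p_d$, $\omega(y):=y+y^{-p}$, $y_p:=p^{1/(p+1)}$, $\mathcal{K}_p:=\lfloor\log_2(2^{p+1}\omega(y_p)^{1+1/p})\rfloor$. Let $A_d^{(k)}:=0$ for $k\le\mathcal{K}_p$; for $k\ge\mathcal{K}_p$ let $m_k:=\lfloor(C_d2^k/e^{\mathrm{avg}}(A_d^{(k)};\widetilde{\mathrm{App}}_d)^2)^{1/(p+1)}y_p\rfloor$; for $k>\mathcal{K}_p$ let $A_d^{(k)}:=A_{d,2^k}(\cdot;\mathcal{P}_k,A_d^{(k-1)},m_{k-1})$ with $s=q=2^{k-1}$ and $\mathcal{P}_k$ a $2^{k-1}$-point set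 satisfying the bound in (i). With $\kappa:=\lfloor\log_2N\rfloor-1$, define $Q_{d,N}:=Q_{d,2^{\kappa+1}}(\cdot;\mathcal{P}^{\mathrm{int}},A_d^{(\kappa)})$, where $\mathcal{P}^{\mathrm{int}}$ is a $2^\kappa$-point set satisfying the bound in (ii) with $n=r=2^\kappa$. *)

theory Defs
  imports "HOL-Probability.Probability"
begin

definition unit_cube :: "(real^'d) set" where
  "unit_cube = {x. \<forall>i. 0 \<le> x $ i \<and> x $ i \<le> 1}"

definition cube_int :: "(real^'d \<Rightarrow> real) \<Rightarrow> real" where
  "cube_int f = integral\<^sup>L (lebesgue_on unit_cube) f"

definition is_L2 :: "(real^'d \<Rightarrow> real) \<Rightarrow> bool" where
  "is_L2 f \<longleftrightarrow> f \<in> borel_measurable (lebesgue_on unit_cube)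
      \<and> integrable (lebesgue_on unit_cube) (\<lambda>x. (f x)\<^sup>2)"

definition L2_inner :: "(real^'d \<Rightarrow> real) \<Rightarrow> (real^'d \<Rightarrow> real) \<Rightarrow> real" where
  "L2_inner f g = cube_int (\<lambda>x. f x * g x)"

section \<open>The RKHS H_d, given abstractly by a Hilbert space and the feature map kv\<close>

text \<open>The element h of the Hilbert space represents the function x |-> <h, kv x>;
  kv x is the element representing K(., x).\<close>

definition rkhs_fun :: "(real^'d \<Rightarrow> 'h::real_inner) \<Rightarrow> 'h \<Rightarrow> real^'d \<Rightarrow> real" where
  "rkhs_fun kv h = (\<lambda>x. inner h (kv x))"

definition separable_space :: "'a::topological_space itself \<Rightarrow> bool" where
  "separable_space _ \<longleftrightarrow> (\<exists>D::'a set. countable D \<and> closure D = UNIV)"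

definition compact_L2_embedding :: "('h::real_normed_vector \<Rightarrow> real^'d \<Rightarrow> real) \<Rightarrow> bool" where
  "compact_L2_embedding emb \<longleftrightarrow>
     (\<forall>s::nat \<Rightarrow> 'h. bounded (range s) \<longrightarrow>
        (\<exists>r::nat \<Rightarrow> nat. strict_mono r \<and>
           (\<forall>e>0. \<exists>M. \<forall>m\<ge>M. \<forall>n\<ge>M. cube_int (\<lambda>x. (emb (s (r m)) x - emb (s (r n)) x)\<^sup>2) < e)))"

text \<open>Standing assumptions on H_d with kernel K and on the eigenpairs of W_d
  (indices j \<ge> 1; index 0 is unused).\<close>

definition rkhs_setting ::
  "(real^'d \<Rightarrow> real^'d \<Rightarrow> real) \<Rightarrow> (real^'d \<Rightarrow> 'h::{real_inner,complete_space})
   \<Rightarrow> (nat \<Rightarrow> real) \<Rightarrow> (nat \<Rightarrow> 'h) \<Rightarrow> bool" where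
  "rkhs_setting K kv lam eta \<longleftrightarrow>
     \<comment> \<open>reproducing kernel\<close>
     (\<forall>x\<in>unit_cube. \<forall>y\<in>unit_cube. K x y = inner (kv x) (kv y))
     \<comment> \<open>H_d is a space of functions on the cube (elements determined by their values there)\<close>
   \<and> (\<forall>h1 h2. (\<forall>x\<in>unit_cube. rkhs_fun kv h1 x = rkhs_fun kv h2 x) \<longrightarrow> h1 = h2)
   \<and> separable_space TYPE('h)
     \<comment> \<open>M_{2,d} < \<infinity>\<close>
   \<and> integrable (lebesgue_on unit_cube) (\<lambda>x. K x x)
     \<comment> \<open>H_d embedded (compactly) in L2\<close>
   \<and> (\<forall>h. is_L2 (rkhs_fun kv h))
   \<and> compact_L2_embedding (rkhs_fun kv)
     \<comment> \<open>eigenvalues\<close>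
   \<and> (\<forall>j\<ge>1. lam j > 0 \<and> lam (Suc j) \<le> lam j)
     \<comment> \<open>eigen equation W_d eta_j = lam_j eta_j\<close>
   \<and> (\<forall>j\<ge>1. \<forall>x\<in>unit_cube.
        cube_int (\<lambda>y. rkhs_fun kv (eta j) y * K x y) = lam j * rkhs_fun kv (eta j) x)
     \<comment> \<open>(eta_j) orthonormal basis of H_d\<close>
   \<and> (\<forall>i\<ge>1. \<forall>j\<ge>1. inner (eta i) (eta j) = (if i = j then 1 else 0))
   \<and> closure (span (eta ` {1..})) = UNIV
     \<comment> \<open>L2-orthogonality and L2 norms\<close>
   \<and> (\<forall>i\<ge>1. \<forall>j\<ge>1. L2_inner (rkhs_fun kv (eta i)) (rkhs_fun kv (eta j))
                     = (if i = j then lam j else 0))"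

definition xi_fun :: "(real^'d \<Rightarrow> 'h::real_inner) \<Rightarrow> (nat \<Rightarrow> real) \<Rightarrow> (nat \<Rightarrow> 'h)
    \<Rightarrow> nat \<Rightarrow> real^'d \<Rightarrow> real" where
  "xi_fun kv lam eta j = (\<lambda>x. rkhs_fun kv (eta j) x / sqrt (lam j))"

definition u_fun :: "(nat \<Rightarrow> real^'d \<Rightarrow> real) \<Rightarrow> nat \<Rightarrow> real^'d \<Rightarrow> real" where
  "u_fun xi m = (\<lambda>x. (1 / real m) * (\<Sum>j=1..m. (xi j x)\<^sup>2))"

text \<open>Tail sum \<Sum>_{j>m} lam_j = e_avg(m; App, Lambda^all)^2.\<close>

definition eig_tail :: "(nat \<Rightarrow> real) \<Rightarrow> nat \<Rightarrow> real" where
  "eig_tail lam m = (\<Sum>i. lam (i + m + 1))"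

definition centered_gaussian :: "'b::real_normed_vector measure \<Rightarrow> bool" where
  "centered_gaussian \<mu> \<longleftrightarrow> prob_space \<mu> \<and> sets \<mu> = sets borel \<and>
     (\<forall>\<phi>::'b \<Rightarrow> real. bounded_linear \<phi> \<longrightarrow>
        (\<exists>\<sigma>\<ge>0. distr \<mu> borel \<phi> =
           (if \<sigma> = 0 then return borel 0 else density lborel (normal_density 0 \<sigma>))))"

definition banach_setting ::
  "(real^'d \<Rightarrow> real^'d \<Rightarrow> real) \<Rightarrow> (real^'d \<Rightarrow> 'h::real_inner)
   \<Rightarrow> ('b::banach \<Rightarrow> real^'d \<Rightarrow> real) \<Rightarrow> 'b measure \<Rightarrow> bool" where
  "banach_setting K kv evb \<mu> \<longleftrightarrow>
     separable_space TYPE('b)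
     \<comment> \<open>elements of B_d are real functions on the cube (linear, injective representation)\<close>
   \<and> (\<forall>x. linear (\<lambda>f. evb f x))
   \<and> (\<forall>f g. (\<forall>x\<in>unit_cube. evb f x = evb g x) \<longrightarrow> f = g)
     \<comment> \<open>H_d \<subseteq> B_d\<close>
   \<and> (\<forall>h. \<exists>f. \<forall>x\<in>unit_cube. evb f x = rkhs_fun kv h x)
     \<comment> \<open>B_d continuously embedded in L2\<close>
   \<and> (\<forall>f. is_L2 (evb f))
   \<and> (\<exists>c. \<forall>f. cube_int (\<lambda>x. (evb f x)\<^sup>2) \<le> c * (norm f)\<^sup>2)
     \<comment> \<open>zero-mean Gaussian measure with covariance kernel K\<close>
   \<and> centered_gaussian \<mu>
   \<and> (\<forall>x\<in>unit_cube. \<forall>y\<in>unit_cube.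
        integrable \<mu> (\<lambda>f. evb f x * evb f y) \<and> K x y = (\<integral>f. evb f x * evb f y \<partial>\<mu>))"

type_synonym 'd alg = "(real^'d \<Rightarrow> real) \<Rightarrow> (real^'d \<Rightarrow> real)"
type_synonym 'd cub = "(real^'d \<Rightarrow> real) \<Rightarrow> real"

definition eavg_app :: "('b \<Rightarrow> real^'d \<Rightarrow> real) \<Rightarrow> 'b measure \<Rightarrow> 'd alg \<Rightarrow> real" where
  "eavg_app evb \<mu> A = sqrt (\<integral>f. cube_int (\<lambda>x. (evb f x - A (evb f) x)\<^sup>2) \<partial>\<mu>)"

definition eavg_int :: "('b \<Rightarrow> real^'d \<Rightarrow> real) \<Rightarrow> 'b measure \<Rightarrow> 'd cub \<Rightarrow> real" where
  "eavg_int evb \<mu> Q = sqrt (\<integral>f. (cube_int (evb f) - Q (evb f))\<^sup>2 \<partial>\<mu>)"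

definition ewor :: "(real^'d \<Rightarrow> 'h::real_inner) \<Rightarrow> 'd cub \<Rightarrow> real" where
  "ewor kv Q = (SUP h\<in>{h::'h. norm h \<le> 1}.
      \<bar>cube_int (rkhs_fun kv h) - Q (rkhs_fun kv h)\<bar>)"

text \<open>Building block (i): A_{d,s+q}(.; P, A, m); the points are P 0, ..., P (q-1).
  Note that a / 0 = 0 in Isabelle, matching the convention 0/0 := 0.\<close>

definition alg_step :: "(nat \<Rightarrow> real^'d \<Rightarrow> real) \<Rightarrow> nat \<Rightarrow> nat \<Rightarrow> (nat \<Rightarrow> real^'d)
    \<Rightarrow> 'd alg \<Rightarrow> 'd alg" where
  "alg_step xi m q P A = (\<lambda>f x. \<Sum>j=1..m.
      (L2_inner (A f) (xi j)
        + (1 / real q) * (\<Sum>l<q. (f (P l) - A f (P l)) * (xi j (P l) / u_fun xi m (P l))))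
      * xi j x)"

definition cub_step :: "'d alg \<Rightarrow> nat \<Rightarrow> (nat \<Rightarrow> real^'d) \<Rightarrow> 'd cub" where
  "cub_step A r P = (\<lambda>f. cube_int (A f) + (1 / real r) * (\<Sum>l<r. f (P l) - A f (P l)))"

definition omega_fn :: "real \<Rightarrow> real \<Rightarrow> real" where
  "omega_fn p y = y + y powr (-p)"

definition y_p :: "real \<Rightarrow> real" where
  "y_p p = p powr (1 / (p + 1))"

definition K_p :: "real \<Rightarrow> nat" where
  "K_p p = nat \<lfloor>log 2 (2 powr (p + 1) * omega_fn p (y_p p) powr (1 + 1 / p))\<rfloor>"

text \<open>m_k as a function of k and of e = e^avg(A_d^(k)).\<close>

definition m_choice :: "real \<Rightarrow> real \<Rightarrow> nat \<Rightarrow> real \<Rightarrow> nat" where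
  "m_choice C p k e = nat \<lfloor>(C * 2 ^ k / e\<^sup>2) powr (1 / (p + 1)) * y_p p\<rfloor>"

text \<open>The sequence A_d^(k); E is the average-case error functional e^avg(.; App),
  P k is the 2^(k-1)-point set P_k.\<close>

primrec alg_seq :: "(nat \<Rightarrow> real^'d \<Rightarrow> real) \<Rightarrow> ('d alg \<Rightarrow> real) \<Rightarrow> real \<Rightarrow> real
    \<Rightarrow> (nat \<Rightarrow> nat \<Rightarrow> real^'d) \<Rightarrow> nat \<Rightarrow> 'd alg" where
  "alg_seq xi E C p P 0 = (\<lambda>f x. 0)"
| "alg_seq xi E C p P (Suc k) =
     (if Suc k \<le> K_p p then (\<lambda>f x. 0)
      else alg_step xi (m_choice C p k (E (alg_seq xi E C p P k))) (2 ^ k) (P (Suc k))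
             (alg_seq xi E C p P k))"

definition kappa :: "nat \<Rightarrow> nat" where
  "kappa N = nat \<lfloor>log 2 (real N)\<rfloor> - 1"

definition constr_A :: "(real^'d \<Rightarrow> 'h::real_inner) \<Rightarrow> (nat \<Rightarrow> real) \<Rightarrow> (nat \<Rightarrow> 'h)
    \<Rightarrow> ('b \<Rightarrow> real^'d \<Rightarrow> real) \<Rightarrow> 'b measure \<Rightarrow> real \<Rightarrow> real
    \<Rightarrow> (nat \<Rightarrow> nat \<Rightarrow> real^'d) \<Rightarrow> nat \<Rightarrow> 'd alg" where
  "constr_A kv lam eta evb \<mu> C p P = alg_seq (xi_fun kv lam eta) (eavg_app evb \<mu>) C p P"

definition constr_m :: "(real^'d \<Rightarrow> 'h::real_inner) \<Rightarrow> (nat \<Rightarrow> real) \<Rightarrow> (nat \<Rightarrow> 'h)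
    \<Rightarrow> ('b \<Rightarrow> real^'d \<Rightarrow> real) \<Rightarrow> 'b measure \<Rightarrow> real \<Rightarrow> real
    \<Rightarrow> (nat \<Rightarrow> nat \<Rightarrow> real^'d) \<Rightarrow> nat \<Rightarrow> nat" where
  "constr_m kv lam eta evb \<mu> C p P k =
     m_choice C p k (eavg_app evb \<mu> (constr_A kv lam eta evb \<mu> C p P k))"

definition constr_Q :: "(real^'d \<Rightarrow> 'h::real_inner) \<Rightarrow> (nat \<Rightarrow> real) \<Rightarrow> (nat \<Rightarrow> 'h)
    \<Rightarrow> ('b \<Rightarrow> real^'d \<Rightarrow> real) \<Rightarrow> 'b measure \<Rightarrow> real \<Rightarrow> real
    \<Rightarrow> (nat \<Rightarrow> nat \<Rightarrow> real^'d) \<Rightarrow> nat \<Rightarrow> (nat \<Rightarrow> real^'d) \<Rightarrow> 'd cub" where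
  "constr_Q kv lam eta evb \<mu> C p P N T =
     cub_step (constr_A kv lam eta evb \<mu> C p P (kappa N)) (2 ^ kappa N) T"

end

theory Submission
  imports Defs
begin

text \<open>For a functional \<open>Z\<close> that is an integral minus a cubature sum, the worst-case error over the unit
  ball of the kernel space equals the average-case error: the random variables
  \<open>\<langle>f, \<eta>\<^sub>j\<rangle> / \<lambda>\<^sub>j\<close> are orthonormal in \<open>L\<^sub>2(\<mu>)\<close> and represent the basis \<open>\<eta>\<^sub>j\<close>. So it suffices to bound
  \<open>a\<^sub>k = e(A\<^sup>(\<^sup>k\<^sup>))\<^sup>2\<close>. The choice of \<open>m\<^sub>k\<close> turns the recursive bound into
  \<open>a\<^sub>k\<^sub>+\<^sub>1 \<le> C \<omega>(y\<^sub>p) (a\<^sub>k / (C 2\<^sup>k))\<^sup>p\<^sup>/\<^sup>(\<^sup>p\<^sup>+\<^sup>1\<^sup>)\<close>, of which \<open>C (2\<^sup>p \<omega>(y\<^sub>p))\<^sup>p\<^sup>+\<^sup>1 2\<^sup>-\<^sup>k\<^sup>p\<close> is a fixed sequence.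

  The interchange of integrals over \<open>\<mu>\<close> and the cube needs joint measurability of \<open>(x, f) \<mapsto> f(x)\<close>,
  which is not a hypothesis. It holds because \<open>f \<mapsto> f(x)\<close> is a Borel linear functional on a Banach
  space, hence continuous by a Baire category argument.\<close>

section \<open>Automatic continuity of Borel linear functionals\<close>

text \<open>Sets of first category, encoded by a countable cover with closed sets of empty interior:
  the Baire theorem speaks of such sets, and subsets inherit the cover.\<close>

definition meagre :: "'a::topological_space set \<Rightarrow> bool" where
  "meagre M \<longleftrightarrow> (\<exists>\<G>. countable \<G> \<and> (\<forall>G\<in>\<G>. closed G \<and> interior G = {}) \<and> M \<subseteq> \<Union>\<G>)"

lemma meagre_subset: "meagre M \<Longrightarrow> L \<subseteq> M \<Longrightarrow> meagre L"
  unfolding meagre_def by (elim exE conjE, intro exI conjI) (assumption | rule order_trans)+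

lemma meagre_empty [simp]: "meagre {}"
  unfolding meagre_def by (intro exI[of _ "{}"]) auto

lemma meagre_UN:
  assumes "countable I" "\<And>i. i \<in> I \<Longrightarrow> meagre (M i)"
  shows "meagre (\<Union>i\<in>I. M i)"
proof -
  obtain \<G> where \<G>: "\<And>i. i \<in> I \<Longrightarrow> countable (\<G> i) \<and> (\<forall>G\<in>\<G> i. closed G \<and> interior G = {}) \<and> M i \<subseteq> \<Union>(\<G> i)"
    using assms(2) unfolding meagre_def by metis
  show ?thesis
    unfolding meagre_def
  proof (intro exI[of _ "\<Union>i\<in>I. \<G> i"] conjI)
    show "countable (\<Union>i\<in>I. \<G> i)" using \<G> assms(1) by auto
    show "\<forall>G\<in>(\<Union>i\<in>I. \<G> i). closed G \<and> interior G = {}" using \<G> by blast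
    show "(\<Union>i\<in>I. M i) \<subseteq> \<Union>(\<Union>i\<in>I. \<G> i)"
    proof (rule UN_least)
      fix i assume "i \<in> I"
      then have "M i \<subseteq> \<Union>(\<G> i)" "\<G> i \<subseteq> (\<Union>i\<in>I. \<G> i)" using \<G> by auto
      then show "M i \<subseteq> \<Union>(\<Union>i\<in>I. \<G> i)" by (meson Union_mono order_trans)
    qed
  qed
qed

lemma meagre_Un:
  assumes "meagre A" "meagre B"
  shows "meagre (A \<union> B)"
proof -
  have "meagre (\<Union>b\<in>UNIV. if b then A else B)"
    using assms by (intro meagre_UN) auto
  moreover have "(\<Union>b\<in>UNIV. if b then A else B) = A \<union> B"
    by (simp add: UNIV_bool Un_commute)
  ultimately show ?thesis by simp
qed

text \<open>The boundary is closed, and an open subset of it would lie in \<open>interior F\<close>,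
  which it avoids.\<close>

lemma meagre_closed_diff_interior:
  assumes "closed F"
  shows "meagre (F - interior F)"
proof -
  have "interior (F - interior F) \<subseteq> interior F \<inter> (F - interior F)"
    using interior_subset[of "F - interior F"] interior_mono[of "F - interior F" F] by blast
  then have "interior (F - interior F) = {}" by blast
  moreover have "closed (F - interior F)" using assms by (intro closed_Diff) auto
  ultimately show ?thesis
    unfolding meagre_def by (intro exI[of _ "{F - interior F}"]) simp
qed

lemma meagre_translation:
  fixes M :: "'a::real_normed_vector set"
  assumes "meagre M"
  shows "meagre ((+) a ` M)"
proof -
  from assms obtain \<G> where \<G>: "countable \<G>" "\<And>G. G \<in> \<G> \<Longrightarrow> closed G \<and> interior G = {}" "M \<subseteq> \<Union>\<G>"
    unfolding meagre_def by blast
  have "(+) a ` M \<subseteq> \<Union>((`) ((+) a) ` \<G>)"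
    using image_mono[OF \<G>(3), of "(+) a"] by (simp add: image_Union)
  moreover have "closed ((+) a ` G) \<and> interior ((+) a ` G) = {}" if "G \<in> \<G>" for G
    using \<G>(2)[OF that] by (simp add: closed_translation interior_translation)
  ultimately show ?thesis
    unfolding meagre_def
    by (intro exI[of _ "(`) ((+) a) ` \<G>"] conjI ballI)
       (auto intro: countable_image[OF \<G>(1)])
qed

text \<open>The Baire category theorem; completeness of the space enters here.\<close>

lemma interior_meagre:
  fixes M :: "'a::complete_space set"
  assumes "meagre M"
  shows "interior M = {}"
proof -
  from assms obtain \<G> where \<G>: "countable \<G>" "\<And>G. G \<in> \<G> \<Longrightarrow> closed G \<and> interior G = {}" "M \<subseteq> \<Union>\<G>"
    unfolding meagre_def by blast
  have "euclidean interior_of (\<Union>\<G>) = {}"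
    by (rule Baire_category_alt)
       (use \<G> completely_metrizable_space_euclidean in \<open>auto\<close>)
  with \<G>(3) show ?thesis using interior_mono[of M "\<Union>\<G>"] by auto
qed

text \<open>Agreeing with an open set up to meagre sets is a property of open sets that survives
  complements and countable unions, so induction over the generated sigma-algebra applies.\<close>

lemma borel_Baire_property:
  assumes "S \<in> sets borel"
  shows "\<exists>U. open U \<and> meagre (S - U) \<and> meagre (U - S)"
proof -
  have "S \<in> sigma_sets UNIV {S. open S}"
    using assms unfolding borel_def by simp
  then show ?thesis
  proof (induction rule: sigma_sets.induct)
    case (Basic S)
    then show ?case by (intro exI[of _ S]) auto
  next
    case Empty
    then show ?case by (intro exI[of _ "{}"]) auto
  next
    case (Compl S)
    then obtain U where U: "open U" "meagre (S - U)" "meagre (U - S)" by blast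
    \<comment> \<open>The complement of \<open>U\<close> is only closed; its interior is the new
      open set, at the cost of a meagre boundary.\<close>
    have *: "meagre (-U - interior (-U))"
      using U(1) by (intro meagre_closed_diff_interior) auto
    have "interior (-U) \<subseteq> -U" by (rule interior_subset)
    then have "interior (-U) - (UNIV - S) \<subseteq> S - U" by auto
    then have 1: "meagre (interior (-U) - (UNIV - S))" using U(2) meagre_subset by blast
    have "(UNIV - S) - interior (-U) \<subseteq> (U - S) \<union> (-U - interior (-U))" by auto
    then have "meagre ((UNIV - S) - interior (-U))"
      using meagre_subset[OF meagre_Un[OF U(3) *]] by blast
    with 1 show ?case by (intro exI[of _ "interior (-U)"]) auto
  next
    case (Union S)
    then obtain U where U: "\<And>i::nat. open (U i)" "\<And>i. meagre (S i - U i)" "\<And>i. meagre (U i - S i)"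
      by metis
    have "meagre (\<Union>i. S i - U i)" "meagre (\<Union>i. U i - S i)"
      using U by (auto intro!: meagre_UN)
    moreover have "(\<Union>i. S i) - (\<Union>i. U i) \<subseteq> (\<Union>i. S i - U i)"
      "(\<Union>i. U i) - (\<Union>i. S i) \<subseteq> (\<Union>i. U i - S i)" by blast+
    ultimately have "meagre ((\<Union>i. S i) - (\<Union>i. U i))" "meagre ((\<Union>i. U i) - (\<Union>i. S i))"
      using meagre_subset by blast+
    with U(1) show ?case by (intro exI[of _ "\<Union>i. U i"]) auto
  qed
qed

text \<open>One of the sets \<open>{\<bar>l\<bar> \<le> n}\<close> is not meagre, hence comeagre in some ball,
  and therefore meets its translates by all small vectors.\<close>

lemma borel_linear_imp_bounded_linear:
  fixes l :: "'a::banach \<Rightarrow> real"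
  assumes lin: "linear l"
    and meas: "\<And>n::nat. {v. \<bar>l v\<bar> \<le> real n} \<in> sets borel"
  shows "bounded_linear l"
proof -
  define S where "S n = {v. \<bar>l v\<bar> \<le> real n}" for n
  have "\<exists>n. \<not> meagre (S n)"
  proof (rule ccontr)
    assume "\<not> ?thesis"
    then have "meagre (\<Union>n. S n)" by (intro meagre_UN) auto
    moreover have "(\<Union>n. S n) = UNIV"
      by (auto simp: S_def intro: real_arch_simple)
    ultimately show False using interior_meagre[of "UNIV :: 'a set"] by simp
  qed
  then obtain n where n: "\<not> meagre (S n)" by blast
  obtain U where U: "open U" "meagre (S n - U)" "meagre (U - S n)"
    using borel_Baire_property[OF meas[of n, folded S_def]] by blast
  have "U \<noteq> {}" using n U(2) by auto
  then obtain a where "a \<in> U" by auto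
  with U(1) obtain r where r: "r > 0" "ball a r \<subseteq> U" by (rule openE)
  have bound: "\<bar>l h\<bar> \<le> 2 * real n" if h: "norm h < r / 2" for h
  proof -
    \<comment> \<open>A meagre set cannot cover the ball of radius \<open>r/2\<close>, so some
      \<open>x\<close> in it avoids both exceptional sets. Then \<open>x\<close> and
      \<open>x - h\<close> lie in \<open>S n\<close>, the half radius keeping \<open>x - h\<close>
      inside \<open>U\<close>, and \<open>l h = l x - l (x - h)\<close> has modulus at most
      \<open>2 * n\<close>.\<close>
    have "meagre ((U - S n) \<union> (+) h ` (U - S n))"
      using U(3) by (intro meagre_Un meagre_translation)
    then have "interior ((U - S n) \<union> (+) h ` (U - S n)) = {}" by (rule interior_meagre)
    moreover have "a \<in> ball a (r/2)" using r(1) by simp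
    ultimately have "\<not> ball a (r/2) \<subseteq> (U - S n) \<union> (+) h ` (U - S n)"
      using interior_maximal[OF _ open_ball, of a "r/2"] by (metis empty_iff subsetD)
    then obtain x where x: "x \<in> ball a (r/2)" "x \<notin> U - S n" "x \<notin> (+) h ` (U - S n)" by blast
    have "x \<in> ball a r" using x(1) r(1) by auto
    then have "x \<in> S n" using x(2) r(2) by auto
    have "dist a (x - h) \<le> dist a x + norm h"
      using norm_triangle_ineq[of "a - x" h] by (simp add: dist_norm algebra_simps)
    then have "x - h \<in> ball a r" using x(1) h by auto
    moreover have "x - h \<notin> U - S n" using x(3) image_eqI[of x "(+) h" "x - h" "U - S n"] by auto
    ultimately have "x - h \<in> S n" using r(2) by auto
    with \<open>x \<in> S n\<close> show ?thesis
      using linear_diff[OF lin, of x h] by (auto simp: S_def)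
  qed
  show ?thesis
  proof (rule bounded_linear_intro[where K = "2 * real n * (4 / r)"])
    show "l (x + y) = l x + l y" for x y using linear_add[OF lin] .
    show "l (c *\<^sub>R x) = c *\<^sub>R l x" for c x using linear_scale[OF lin] by simp
    show "norm (l x) \<le> norm x * (2 * real n * (4 / r))" for x
    proof (cases "x = 0")
      case True then show ?thesis using linear_0[OF lin] by simp
    next
      case False
      \<comment> \<open>Scaling \<open>x\<close> to norm \<open>r / 4\<close> stays strictly below
        the radius \<open>r / 2\<close> where \<open>bound\<close> applies.\<close>
      define c where "c = r / 4 / norm x"
      have c: "c > 0" using False r by (simp add: c_def)
      have "norm (c *\<^sub>R x) < r / 2" using False r by (simp add: c_def)
      from bound[OF this] have "c * \<bar>l x\<bar> \<le> 2 * real n"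
        using c linear_scale[OF lin, of c x] by (simp add: abs_mult)
      then have "\<bar>l x\<bar> \<le> 2 * real n / c" using c by (simp add: field_simps)
      also have "2 * real n / c = norm x * (2 * real n * (4 / r))"
        using False r by (simp add: c_def)
      finally show ?thesis by simp
    qed
  qed
qed

section \<open>Square-integrable functions and partial integrals\<close>

text \<open>\<open>is_L2\<close> is tied to the cube; the same notion is needed on the Gaussian
  measure and on the product.\<close>

definition sq_integrable :: "'a measure \<Rightarrow> ('a \<Rightarrow> real) \<Rightarrow> bool" where
  "sq_integrable M f \<longleftrightarrow> f \<in> borel_measurable M \<and> integrable M (\<lambda>x. (f x)\<^sup>2)"

lemma sq_integrableD:
  assumes "sq_integrable M f"
  shows "f \<in> borel_measurable M" "integrable M (\<lambda>x. (f x)\<^sup>2)"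
  using assms by (auto simp: sq_integrable_def)

lemma sq_integrable_mult:
  assumes f: "sq_integrable M f" and g: "sq_integrable M g"
  shows "integrable M (\<lambda>x. f x * g x)"
proof (rule Bochner_Integration.integrable_bound)
  show "integrable M (\<lambda>x. (f x)\<^sup>2 + (g x)\<^sup>2)"
    using f g by (auto simp: sq_integrable_def)
  show "(\<lambda>x. f x * g x) \<in> borel_measurable M"
    using f g by (auto simp: sq_integrable_def)
  have "\<bar>a * b\<bar> \<le> a\<^sup>2 + b\<^sup>2" for a b :: real
  proof -
    have "2 * \<bar>a * b\<bar> \<le> a\<^sup>2 + b\<^sup>2"
      using sum_squares_bound[of "\<bar>a\<bar>" "\<bar>b\<bar>"] by (simp add: abs_mult)
    then show ?thesis by linarith
  qed
  then show "AE x in M. norm (f x * g x) \<le> norm ((f x)\<^sup>2 + (g x)\<^sup>2)"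
    by (intro AE_I2) simp
qed

lemma sq_integrable_cmult:
  assumes "sq_integrable M f"
  shows "sq_integrable M (\<lambda>x. c * f x)"
  using assms by (auto simp: sq_integrable_def power_mult_distrib)

lemma sq_integrable_add:
  assumes f: "sq_integrable M f" and g: "sq_integrable M g"
  shows "sq_integrable M (\<lambda>x. f x + g x)"
proof -
  have "integrable M (\<lambda>x. (f x)\<^sup>2 + (g x)\<^sup>2 + 2 * (f x * g x))"
    using f g sq_integrable_mult[OF f g] by (auto simp: sq_integrable_def)
  then show ?thesis
    using sq_integrableD(1)[OF f] sq_integrableD(1)[OF g]
    by (simp add: sq_integrable_def power2_sum mult.assoc)
qed

lemma sq_integrable_diff:
  assumes "sq_integrable M f" "sq_integrable M g"
  shows "sq_integrable M (\<lambda>x. f x - g x)"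
  using sq_integrable_add[OF assms(1) sq_integrable_cmult[OF assms(2), of "-1"]] by simp

lemma sq_integrable_sum:
  assumes "\<And>i. i \<in> I \<Longrightarrow> sq_integrable M (f i)"
  shows "sq_integrable M (\<lambda>x. \<Sum>i\<in>I. f i x)"
  using assms
proof (induction I rule: infinite_finite_induct)
  case (insert i I)
  then show ?case using sq_integrable_add[of M "f i"] by simp
qed (auto simp: sq_integrable_def)

lemma (in finite_measure) sq_integrable_const: "sq_integrable M (\<lambda>x. c)"
  by (simp add: sq_integrable_def)

text \<open>The quadratic form in \<open>(s, t)\<close> is the integral of a square. At
  \<open>s = ?b\<close>, \<open>t = ?a\<close> it equals \<open>?a * (?a * ?c - ?b\<^sup>2)\<close>,
  which settles the case \<open>?a > 0\<close>.\<close>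

lemma Cauchy_Schwarz_integral:
  assumes f: "sq_integrable M f" and g: "sq_integrable M g"
  shows "(\<integral>x. f x * g x \<partial>M)\<^sup>2 \<le> (\<integral>x. (f x)\<^sup>2 \<partial>M) * (\<integral>x. (g x)\<^sup>2 \<partial>M)"
proof -
  let ?a = "\<integral>x. (f x)\<^sup>2 \<partial>M" and ?b = "\<integral>x. f x * g x \<partial>M" and ?c = "\<integral>x. (g x)\<^sup>2 \<partial>M"
  have q: "0 \<le> s\<^sup>2 * ?a - 2 * s * t * ?b + t\<^sup>2 * ?c" for s t
  proof -
    have "0 \<le> (\<integral>x. (s * f x - t * g x)\<^sup>2 \<partial>M)" by simp
    also have "\<dots> = (\<integral>x. s\<^sup>2 * (f x)\<^sup>2 - (2 * s * t) * (f x * g x) + t\<^sup>2 * (g x)\<^sup>2 \<partial>M)"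
      by (intro Bochner_Integration.integral_cong refl) (simp add: power2_eq_square algebra_simps)
    also have "\<dots> = s\<^sup>2 * ?a - 2 * s * t * ?b + t\<^sup>2 * ?c"
      using sq_integrableD(2)[OF f] sq_integrableD(2)[OF g] sq_integrable_mult[OF f g] by simp
    finally show ?thesis .
  qed
  have ac: "?a \<ge> 0" "?c \<ge> 0" by simp_all
  show ?thesis
  proof (cases "?a = 0")
    case True
    have "?b = 0"
    proof (rule ccontr)
      assume b: "?b \<noteq> 0"
      \<comment> \<open>With \<open>?a = 0\<close> the form is affine in its first argument, and
        here it would equal -1.\<close>
      define t where "t = (?c + 1) / (2 * ?b)"
      have "2 * t * ?b = ?c + 1" using b by (simp add: t_def)
      moreover have "0 \<le> ?c - 2 * t * ?b" using q[of t 1] unfolding True by simp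
      ultimately show False by linarith
    qed
    then show ?thesis using ac by simp
  next
    case False
    have "0 \<le> ?a * (?a * ?c - ?b\<^sup>2)"
      using q[of ?b ?a] by (simp add: power2_eq_square algebra_simps)
    then have "0 \<le> ?a * ?c - ?b\<^sup>2"
      using False ac by (simp add: zero_le_mult_iff)
    then show ?thesis by simp
  qed
qed

section \<open>Fubini for products of square-integrable functions\<close>

context pair_sigma_finite
begin

lemma sq_integrable_tensor:
  assumes g: "sq_integrable M1 g" and Y: "sq_integrable M2 Y"
  shows "sq_integrable (M1 \<Otimes>\<^sub>M M2) (\<lambda>(x, w). g x * Y w)"
proof -
  note [measurable] = sq_integrableD(1)[OF g] sq_integrableD(1)[OF Y]
  have "integrable (M1 \<Otimes>\<^sub>M M2) (\<lambda>(x, w). (g x)\<^sup>2 * (Y w)\<^sup>2)"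
    by (rule Fubini_integrable)
       (use sq_integrableD(2)[OF g] sq_integrableD(2)[OF Y] in \<open>auto simp: abs_mult\<close>)
  then show ?thesis
    by (simp add: sq_integrable_def case_prod_unfold power_mult_distrib)
qed

text \<open>The tensor of \<open>g\<close> and \<open>Y\<close> and the kernel \<open>F\<close> are
  both square integrable on the product space, so their product is integrable and Fubini
  applies.\<close>

lemma integral_swap_tensor:
  fixes F :: "'a \<Rightarrow> 'b \<Rightarrow> real"
  assumes F: "sq_integrable (M1 \<Otimes>\<^sub>M M2) (case_prod F)"
    and g: "sq_integrable M1 g" and Y: "sq_integrable M2 Y"
  shows "integrable M1 (\<lambda>x. g x * (\<integral>w. Y w * F x w \<partial>M2))"
    and "integrable M2 (\<lambda>w. Y w * (\<integral>x. g x * F x w \<partial>M1))"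
    and "(\<integral>w. Y w * (\<integral>x. g x * F x w \<partial>M1) \<partial>M2) = (\<integral>x. g x * (\<integral>w. Y w * F x w \<partial>M2) \<partial>M1)"
proof -
  have *: "integrable (M1 \<Otimes>\<^sub>M M2) (\<lambda>(x, w). g x * (Y w * F x w))"
    using sq_integrable_mult[OF sq_integrable_tensor[OF g Y] F]
    by (simp add: case_prod_unfold mult.assoc)
  have eq: "(\<integral>w. g x * (Y w * F x w) \<partial>M2) = g x * (\<integral>w. Y w * F x w \<partial>M2)" for x
    by simp
  have eq': "(\<integral>x. g x * (Y w * F x w) \<partial>M1) = Y w * (\<integral>x. g x * F x w \<partial>M1)" for w
  proof -
    have "(\<integral>x. g x * (Y w * F x w) \<partial>M1) = (\<integral>x. Y w * (g x * F x w) \<partial>M1)"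
      by (simp add: mult.left_commute)
    then show ?thesis by simp
  qed
  show "integrable M1 (\<lambda>x. g x * (\<integral>w. Y w * F x w \<partial>M2))"
    using integrable_fst[OF *] by simp
  show "integrable M2 (\<lambda>w. Y w * (\<integral>x. g x * F x w \<partial>M1))"
    using integrable_snd[OF *] by (simp add: eq')
  show "(\<integral>w. Y w * (\<integral>x. g x * F x w \<partial>M1) \<partial>M2) = (\<integral>x. g x * (\<integral>w. Y w * F x w \<partial>M2) \<partial>M1)"
    using Fubini_integral[OF *] by (simp add: eq')
qed

end

text \<open>Cauchy-Schwarz for each fixed \<open>w\<close> dominates the squared partial integral by
  a constant times the integral of \<open>(F x w)\<^sup>2\<close>, which Fubini makes integrable.
  Since \<open>M2\<close> is finite, \<open>Y = 1\<close> is admissible in the swap lemma and yields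
  measurability.\<close>

lemma sq_integrable_partial_integral:
  fixes F :: "'a \<Rightarrow> 'b \<Rightarrow> real"
  assumes fin: "sigma_finite_measure M1" "finite_measure M2"
    and F: "sq_integrable (M1 \<Otimes>\<^sub>M M2) (case_prod F)"
    and Fw: "\<And>w. w \<in> space M2 \<Longrightarrow> sq_integrable M1 (\<lambda>x. F x w)"
    and g: "sq_integrable M1 g"
  shows "sq_integrable M2 (\<lambda>w. \<integral>x. g x * F x w \<partial>M1)"
proof -
  interpret M1: sigma_finite_measure M1 by fact
  interpret M2: finite_measure M2 by fact
  interpret pair_sigma_finite M1 M2 ..
  have "integrable M2 (\<lambda>w. 1 * (\<integral>x. g x * F x w \<partial>M1))"
    by (rule integral_swap_tensor(2)[OF F g M2.sq_integrable_const])
  then have meas [measurable]: "(\<lambda>w. \<integral>x. g x * F x w \<partial>M1) \<in> borel_measurable M2" by simp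
  have "integrable (M1 \<Otimes>\<^sub>M M2) (\<lambda>(x, w). (F x w)\<^sup>2)"
    using sq_integrableD(2)[OF F] by (simp add: case_prod_unfold)
  from integrable_snd[OF this]
  have int: "integrable M2 (\<lambda>w. (\<integral>x. (g x)\<^sup>2 \<partial>M1) * (\<integral>x. (F x w)\<^sup>2 \<partial>M1))" by simp
  have "integrable M2 (\<lambda>w. (\<integral>x. g x * F x w \<partial>M1)\<^sup>2)"
  proof (rule Bochner_Integration.integrable_bound[OF int])
    show "AE w in M2. norm ((\<integral>x. g x * F x w \<partial>M1)\<^sup>2) \<le> norm ((\<integral>x. (g x)\<^sup>2 \<partial>M1) * (\<integral>x. (F x w)\<^sup>2 \<partial>M1))"
      using Cauchy_Schwarz_integral[OF g Fw] by (intro AE_I2) simp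
  qed measurable
  then show ?thesis using meas by (simp add: sq_integrable_def)
qed

text \<open>The continuous variable is approximated by the points of a dense sequence.\<close>

lemma borel_measurable_Caratheodory:
  fixes F :: "'a \<Rightarrow> 'b::metric_space \<Rightarrow> real"
  assumes sep: "separable_space TYPE('b)"
    and cont: "\<And>x. x \<in> space M \<Longrightarrow> continuous_on UNIV (F x)"
    and meas: "\<And>w. (\<lambda>x. F x w) \<in> borel_measurable M"
    and N: "sets N = sets (borel :: 'b measure)"
  shows "case_prod F \<in> borel_measurable (M \<Otimes>\<^sub>M N)"
proof -
  obtain D :: "'b set" where D: "countable D" "closure D = UNIV"
    using sep unfolding separable_space_def by blast
  have "D \<noteq> {}" using D(2) by auto
  define d where "d = from_nat_into D"
  have dense: "\<exists>k. dist (d k) w < e" if "e > 0" for w e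
  proof -
    have "w \<in> closure D" using D(2) by simp
    then obtain v where "v \<in> D" "dist v w < e"
      using \<open>e > 0\<close> unfolding closure_approachable by blast
    then show ?thesis
      using from_nat_into_surj[OF D(1)] unfolding d_def by metis
  qed
  \<comment> \<open>Taking the least index makes the selection measurable: \<open>k n\<close> has
    countably many values, and on each of them \<open>F\<close> is a measurable function of
    \<open>x\<close> alone.\<close>
  define k where "k n w = (LEAST k. dist (d k) w < 1 / real (Suc n))" for n w
  have k: "dist (d (k n w)) w < 1 / real (Suc n)" for n w
    unfolding k_def by (rule LeastI_ex) (simp add: dense)
  have [measurable]: "(\<lambda>w. dist (d j) w) \<in> borel_measurable N" for j
    unfolding measurable_cong_sets[OF N refl]
    by (intro borel_measurable_continuous_onI continuous_intros)
  have k_meas [measurable]: "k n \<in> measurable N (count_space UNIV)" for n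
    unfolding k_def by measurable
  have approx: "(\<lambda>z. F (fst z) (d (k n (snd z)))) \<in> borel_measurable (M \<Otimes>\<^sub>M N)" for n
  proof (rule measurable_compose_countable)
    show "(\<lambda>z. F (fst z) (d j)) \<in> borel_measurable (M \<Otimes>\<^sub>M N)" for j
      by (rule measurable_compose[OF measurable_fst meas])
    show "(\<lambda>z. k n (snd z)) \<in> measurable (M \<Otimes>\<^sub>M N) (count_space UNIV)"
      by measurable
  qed
  have "(\<lambda>z. F (fst z) (snd z)) \<in> borel_measurable (M \<Otimes>\<^sub>M N)"
  proof (rule borel_measurable_LIMSEQ_real[OF _ approx])
    fix z assume "z \<in> space (M \<Otimes>\<^sub>M N)"
    then have x: "fst z \<in> space M" by (auto simp: space_pair_measure)
    have "(\<lambda>n. dist (d (k n (snd z))) (snd z)) \<longlonglongrightarrow> 0"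
    proof (rule tendsto_sandwich[OF _ _ tendsto_const LIMSEQ_Suc[OF lim_1_over_n]])
      show "\<forall>\<^sub>F n in sequentially. dist (d (k n (snd z))) (snd z) \<le> 1 / real (Suc n)"
        using k less_imp_le by (intro always_eventually) blast
    qed auto
    then have "(\<lambda>n. d (k n (snd z))) \<longlonglongrightarrow> snd z"
      by (rule tendsto_dist_iff[THEN iffD2])
    then show "(\<lambda>n. F (fst z) (d (k n (snd z)))) \<longlonglongrightarrow> F (fst z) (snd z)"
      by (rule continuous_on_tendsto_compose[OF cont[OF x]]) simp_all
  qed
  then show ?thesis by (simp add: case_prod_unfold)
qed

section \<open>Orthonormal expansions and sampling algorithms\<close>

text \<open>The weights are chosen before the function, so the functional is linear and nonadaptive.
  The nodes form a set, so coinciding sample points count once.\<close>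

definition point_functional :: "'a set \<Rightarrow> (('a \<Rightarrow> real) \<Rightarrow> real) \<Rightarrow> bool" where
  "point_functional S \<phi> \<longleftrightarrow> (\<exists>w. \<forall>f. \<phi> f = (\<Sum>t\<in>S. w t * f t))"

lemma point_functional_eval:
  assumes "finite S" "t \<in> S"
  shows "point_functional S (\<lambda>f. f t)"
  unfolding point_functional_def
proof (intro exI allI)
  show "f t = (\<Sum>s\<in>S. (if s = t then 1 else 0) * f s)" for f :: "'a \<Rightarrow> real"
    using assms by (simp add: if_distrib[of "\<lambda>c. c * _"] cong: if_cong)
qed

lemma point_functional_cmult:
  assumes "point_functional S \<phi>"
  shows "point_functional S (\<lambda>f. c * \<phi> f)"
proof -
  obtain w where "\<And>f. \<phi> f = (\<Sum>t\<in>S. w t * f t)"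
    using assms unfolding point_functional_def by blast
  then show ?thesis
    unfolding point_functional_def
    by (intro exI[of _ "\<lambda>t. c * w t"]) (simp add: sum_distrib_left mult.assoc)
qed

lemma point_functional_add:
  assumes "point_functional S \<phi>" "point_functional S \<psi>"
  shows "point_functional S (\<lambda>f. \<phi> f + \<psi> f)"
proof -
  obtain w v where "\<And>f. \<phi> f = (\<Sum>t\<in>S. w t * f t)" "\<And>f. \<psi> f = (\<Sum>t\<in>S. v t * f t)"
    using assms unfolding point_functional_def by blast
  then show ?thesis
    unfolding point_functional_def
    by (intro exI[of _ "\<lambda>t. w t + v t"]) (simp add: sum.distrib distrib_right)
qed

lemma point_functional_diff:
  assumes "point_functional S \<phi>" "point_functional S \<psi>"
  shows "point_functional S (\<lambda>f. \<phi> f - \<psi> f)"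
  using point_functional_add[OF assms(1) point_functional_cmult[OF assms(2), of "-1"]] by simp

lemma point_functional_zero: "point_functional S (\<lambda>f. 0)"
  unfolding point_functional_def by (intro exI[of _ "\<lambda>_. 0"]) simp

lemma point_functional_sum:
  assumes "\<And>i. i \<in> I \<Longrightarrow> point_functional S (\<phi> i)"
  shows "point_functional S (\<lambda>f. \<Sum>i\<in>I. \<phi> i f)"
  using assms
proof (induction I rule: infinite_finite_induct)
  case (insert i I)
  then show ?case using point_functional_add[of S "\<phi> i"] by simp
qed (simp_all add: point_functional_zero)

lemma point_functional_mono:
  assumes "point_functional S \<phi>" "S \<subseteq> T" "finite T"
  shows "point_functional T \<phi>"
proof -
  obtain w where w: "\<And>f. \<phi> f = (\<Sum>t\<in>S. w t * f t)"
    using assms unfolding point_functional_def by blast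
  have "\<phi> f = (\<Sum>t\<in>T. (if t \<in> S then w t else 0) * f t)" for f
    unfolding w using assms by (intro sum.mono_neutral_cong_left) auto
  then show ?thesis
    unfolding point_functional_def by (intro exI[of _ "\<lambda>t. if t \<in> S then w t else 0"]) simp
qed

text \<open>The finite range \<open>1..M\<close> later leaves the next eigenfunction orthogonal to
  every output.\<close>

definition point_algorithm :: "(nat \<Rightarrow> real^'d \<Rightarrow> real) \<Rightarrow> (real^'d) set \<Rightarrow> nat \<Rightarrow> 'd alg \<Rightarrow> bool" where
  "point_algorithm xi S M A \<longleftrightarrow> (\<exists>\<phi>. (\<forall>j. point_functional S (\<phi> j)) \<and>
      (\<forall>f x. A f x = (\<Sum>j=1..M. \<phi> j f * xi j x)))"

lemma point_algorithm_zero: "point_algorithm xi {} 0 (\<lambda>f x. 0)"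
  unfolding point_algorithm_def
  by (intro exI[of _ "\<lambda>_ _. 0"]) (simp add: point_functional_zero)

lemma point_functional_algorithm_eval:
  assumes "point_algorithm xi S M A"
  shows "point_functional S (\<lambda>f. A f x)"
proof -
  obtain \<phi> where \<phi>: "\<And>j. point_functional S (\<phi> j)" "\<And>f x. A f x = (\<Sum>j=1..M. \<phi> j f * xi j x)"
    using assms unfolding point_algorithm_def by blast
  have "point_functional S (\<lambda>f. \<Sum>j=1..M. xi j x * \<phi> j f)"
    by (intro point_functional_sum point_functional_cmult \<phi>(1))
  then show ?thesis by (simp add: \<phi>(2) mult.commute)
qed

text \<open>Used with \<open>g = xi j\<close> for the inner products in \<open>alg_step\<close> and
  with \<open>g = 1\<close> for the integral in \<open>cub_step\<close>.\<close>

lemma point_functional_algorithm_integral: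
  assumes A: "point_algorithm xi S M A"
    and int: "\<And>j. integrable (lebesgue_on unit_cube) (\<lambda>x. xi j x * g x)"
  shows "point_functional S (\<lambda>f. cube_int (\<lambda>x. A f x * g x))"
proof -
  obtain \<phi> where \<phi>: "\<And>j. point_functional S (\<phi> j)" "\<And>f x. A f x = (\<Sum>j=1..M. \<phi> j f * xi j x)"
    using A unfolding point_algorithm_def by blast
  have "cube_int (\<lambda>x. A f x * g x) = (\<Sum>j=1..M. cube_int (\<lambda>x. xi j x * g x) * \<phi> j f)" for f
  proof -
    have "cube_int (\<lambda>x. A f x * g x) = cube_int (\<lambda>x. \<Sum>j=1..M. \<phi> j f * (xi j x * g x))"
      by (simp add: \<phi>(2) sum_distrib_right mult.assoc)
    also have "\<dots> = (\<Sum>j=1..M. \<phi> j f * cube_int (\<lambda>x. xi j x * g x))"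
      using int unfolding cube_int_def by (subst Bochner_Integration.integral_sum) auto
    finally show ?thesis by (simp add: mult.commute)
  qed
  moreover have "point_functional S (\<lambda>f. \<Sum>j=1..M. cube_int (\<lambda>x. xi j x * g x) * \<phi> j f)"
    by (intro point_functional_sum point_functional_cmult \<phi>(1))
  ultimately show ?thesis by simp
qed

lemma point_functional_residual:
  fixes P :: "nat \<Rightarrow> real^'d"
  assumes A: "point_algorithm xi S M A" and S: "finite S" and l: "l < q"
  shows "point_functional (S \<union> P ` {..<q}) (\<lambda>f. f (P l) - A f (P l))"
proof (rule point_functional_diff)
  show "point_functional (S \<union> P ` {..<q}) (\<lambda>f. f (P l))"
    using S l by (intro point_functional_eval) auto
  show "point_functional (S \<union> P ` {..<q}) (\<lambda>f. A f (P l))"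
    using S by (intro point_functional_mono[OF point_functional_algorithm_eval[OF A]]) auto
qed

lemma point_algorithm_alg_step:
  assumes A: "point_algorithm xi S M A" and S: "finite S"
    and int: "\<And>i j. integrable (lebesgue_on unit_cube) (\<lambda>x. xi i x * xi j x)"
  shows "point_algorithm xi (S \<union> P ` {..<q}) m (alg_step xi m q P A)"
  unfolding point_algorithm_def
proof (intro exI conjI allI)
  let ?\<phi> = "\<lambda>j f. L2_inner (A f) (xi j)
        + (1 / real q) * (\<Sum>l<q. (xi j (P l) / u_fun xi m (P l)) * (f (P l) - A f (P l)))"
  show "point_functional (S \<union> P ` {..<q}) (?\<phi> j)" for j
  proof (rule point_functional_add)
    have "point_functional S (\<lambda>f. L2_inner (A f) (xi j))"
      unfolding L2_inner_def by (rule point_functional_algorithm_integral[OF A]) (rule int)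
    then show "point_functional (S \<union> P ` {..<q}) (\<lambda>f. L2_inner (A f) (xi j))"
      using S by (elim point_functional_mono) auto
    show "point_functional (S \<union> P ` {..<q}) (\<lambda>f. (1 / real q) *
        (\<Sum>l<q. (xi j (P l) / u_fun xi m (P l)) * (f (P l) - A f (P l))))"
      by (rule point_functional_cmult, rule point_functional_sum, rule point_functional_cmult)
         (simp add: point_functional_residual[OF A S])
  qed
  show "alg_step xi m q P A f x = (\<Sum>j=1..m. ?\<phi> j f * xi j x)" for f x
    by (simp add: alg_step_def mult.commute)
qed

text \<open>The strict bound is inductive: fewer than \<open>2 ^ k\<close> old nodes and at most
  \<open>2 ^ k\<close> new ones, starting from none. \<open>m_choice\<close> depends on an average
  error and not on the input function, so the algorithm stays linear.\<close>

lemma point_algorithm_alg_seq: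
  assumes int: "\<And>i j. integrable (lebesgue_on unit_cube) (\<lambda>x. xi i x * xi j x)"
    and P: "\<And>i l. K_p p < i \<Longrightarrow> i \<le> k \<Longrightarrow> l < 2 ^ (i - 1) \<Longrightarrow> P i l \<in> unit_cube"
  shows "\<exists>S M. finite S \<and> S \<subseteq> unit_cube \<and> card S < 2 ^ k \<and> point_algorithm xi S M (alg_seq xi E C p P k)"
  using P
proof (induction k)
  case 0
  show ?case by (intro exI[of _ "{}"] exI[of _ 0]) (simp add: point_algorithm_zero)
next
  case (Suc k)
  show ?case
  proof (cases "Suc k \<le> K_p p")
    case True
    then show ?thesis by (intro exI[of _ "{}"] exI[of _ 0]) (simp add: point_algorithm_zero)
  next
    case False
    obtain S M where S: "finite S" "S \<subseteq> unit_cube" "card S < 2 ^ k"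
        "point_algorithm xi S M (alg_seq xi E C p P k)"
      using Suc.IH Suc.prems by (metis le_SucI)
    let ?S = "S \<union> P (Suc k) ` {..<2 ^ k}"
    have "card ?S \<le> card S + card (P (Suc k) ` {..<2 ^ k :: nat})"
      by (rule card_Un_le)
    also have "\<dots> \<le> card S + 2 ^ k"
      using card_image_le[of "{..<2 ^ k :: nat}" "P (Suc k)"] by simp
    finally have "card ?S < 2 ^ Suc k" using S(3) by simp
    moreover have "?S \<subseteq> unit_cube" using S(2) Suc.prems[of "Suc k"] False by auto
    moreover have "point_algorithm xi ?S (m_choice C p k (E (alg_seq xi E C p P k))) (alg_seq xi E C p P (Suc k))"
      using point_algorithm_alg_step[OF S(4,1) int] False by simp
    moreover have "finite ?S" using S(1) by simp
    ultimately show ?thesis by (intro exI conjI)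
  qed
qed

lemma point_functional_cub_step:
  assumes A: "point_algorithm xi S M A" and S: "finite S"
    and int: "\<And>j. integrable (lebesgue_on unit_cube) (xi j)"
  shows "point_functional (S \<union> T ` {..<r}) (cub_step A r T)"
proof -
  have "point_functional S (\<lambda>f. cube_int (A f))"
    using point_functional_algorithm_integral[OF A, of "\<lambda>_. 1"] int by simp
  then have "point_functional (S \<union> T ` {..<r}) (\<lambda>f. cube_int (A f))"
    using S by (elim point_functional_mono) auto
  moreover have "point_functional (S \<union> T ` {..<r}) (\<lambda>f. (1 / real r) * (\<Sum>l<r. f (T l) - A f (T l)))"
    by (rule point_functional_cmult, rule point_functional_sum)
       (simp add: point_functional_residual[OF A S])
  ultimately show ?thesis
    unfolding cub_step_def by (rule point_functional_add)
qed

text \<open>The squared distance from \<open>v\<close> to a finite combination splits into the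
  residual of the Fourier projection and the squared deviations of the coefficients. This gives
  Bessel's inequality and, along approximating combinations, the reverse inequality.\<close>

lemma Parseval:
  fixes v :: "'h::real_inner" and e :: "nat \<Rightarrow> 'h"
  assumes orth: "\<And>i j. inner (e i) (e j) = (if i = j then 1 else 0)"
    and finite_approx: "\<And>\<epsilon>. \<epsilon> > 0 \<Longrightarrow> \<exists>J c. finite J \<and> norm (v - (\<Sum>j\<in>J. c j *\<^sub>R e j)) < \<epsilon>"
  shows "(\<lambda>j. (inner v (e j))\<^sup>2) sums (norm v)\<^sup>2"
proof -
  have dist: "(norm (v - (\<Sum>j\<in>J. c j *\<^sub>R e j)))\<^sup>2
      = (norm v)\<^sup>2 - (\<Sum>j\<in>J. (inner v (e j))\<^sup>2) + (\<Sum>j\<in>J. (c j - inner v (e j))\<^sup>2)"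
    if "finite J" for J c
  proof -
    let ?h = "\<Sum>j\<in>J. c j *\<^sub>R e j"
    have "inner ?h ?h = (\<Sum>i\<in>J. \<Sum>j\<in>J. c i * (c j * inner (e j) (e i)))"
      by (simp add: inner_sum_left inner_sum_right sum_distrib_left)
    also have "\<dots> = (\<Sum>i\<in>J. \<Sum>j\<in>J. if i = j then (c i)\<^sup>2 else 0)"
      by (intro sum.cong refl) (simp add: orth power2_eq_square)
    also have "\<dots> = (\<Sum>j\<in>J. (c j)\<^sup>2)" using that by simp
    finally have hh: "inner ?h ?h = (\<Sum>j\<in>J. (c j)\<^sup>2)" .
    have vh: "inner v ?h = (\<Sum>j\<in>J. c j * inner v (e j))" by (simp add: inner_sum_right)
    have "(norm (v - ?h))\<^sup>2 = (norm v)\<^sup>2 - 2 * inner v ?h + inner ?h ?h"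
      by (simp add: power2_norm_eq_inner inner_diff_left inner_diff_right inner_commute)
    then show ?thesis
      unfolding hh vh by (simp add: power2_diff sum.distrib sum_subtractf sum_distrib_left mult_ac)
  qed
  have Bessel: "(\<Sum>j\<in>J. (inner v (e j))\<^sup>2) \<le> (norm v)\<^sup>2" if "finite J" for J
    using dist[OF that, of "\<lambda>j. inner v (e j)"] zero_le_power2[of "norm (v - (\<Sum>j\<in>J. inner v (e j) *\<^sub>R e j))"]
    by simp
  have summable: "summable (\<lambda>j. (inner v (e j))\<^sup>2)"
    by (rule summableI_nonneg_bounded[of _ "(norm v)\<^sup>2"]) (auto intro: Bessel)
  have "(norm v)\<^sup>2 \<le> (\<Sum>j. (inner v (e j))\<^sup>2)"
  proof (rule field_le_epsilon)
    fix \<delta> :: real assume "\<delta> > 0"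
    then obtain J c where J: "finite J" "norm (v - (\<Sum>j\<in>J. c j *\<^sub>R e j)) < sqrt \<delta>"
      using finite_approx[of "sqrt \<delta>"] by auto
    then have "(norm (v - (\<Sum>j\<in>J. c j *\<^sub>R e j)))\<^sup>2 \<le> \<delta>"
      using \<open>\<delta> > 0\<close> power_mono[OF less_imp_le[OF J(2)] norm_ge_zero, of 2] by simp
    moreover have "0 \<le> (\<Sum>j\<in>J. (c j - inner v (e j))\<^sup>2)" by (simp add: sum_nonneg)
    ultimately have "(norm v)\<^sup>2 \<le> (\<Sum>j\<in>J. (inner v (e j))\<^sup>2) + \<delta>"
      using dist[OF J(1), of c] by linarith
    also have "(\<Sum>j\<in>J. (inner v (e j))\<^sup>2) \<le> (\<Sum>j. (inner v (e j))\<^sup>2)"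
      by (rule sum_le_suminf[OF summable J(1)]) simp
    finally show "(norm v)\<^sup>2 \<le> (\<Sum>j. (inner v (e j))\<^sup>2) + \<delta>" by simp
  qed
  moreover have "(\<Sum>j. (inner v (e j))\<^sup>2) \<le> (norm v)\<^sup>2"
    by (rule suminf_le_const[OF summable]) (rule Bessel, simp)
  ultimately show ?thesis using summable_sums[OF summable] by simp
qed

section \<open>The error recursion\<close>

lemma omega_fn_ge_1:
  assumes "p > 0" "y > 0"
  shows "omega_fn p y \<ge> 1"
proof (cases "y \<ge> 1")
  case True
  then show ?thesis unfolding omega_fn_def by (smt (verit) powr_ge_zero)
next
  case False
  then have "y powr p \<le> 1"
    using assms powr_mono2[of p y 1] by simp
  then have "y powr (-p) \<ge> 1"
    using assms(2) by (simp add: powr_minus field_simps)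
  then show ?thesis unfolding omega_fn_def using assms(2) by linarith
qed

lemma y_p_pos: "p > 0 \<Longrightarrow> y_p p > 0"
  by (simp add: y_p_def)

text \<open>\<open>y_p p\<close> is the minimiser of omega, the root of
  \<open>y powr (p + 1) = p\<close>. Hence \<open>y = p * y powr (- p)\<close>, and omega collapses
  to \<open>(1 + p) * y powr (- p)\<close>; the factor \<open>q\<close> below is this power.\<close>

lemma omega_fn_y_p_powr:
  assumes "p > 0"
  shows "omega_fn p (y_p p) powr (p + 1) = (1 + p) * (1 + 1 / p) powr p"
proof -
  define q where "q = p powr (- (p / (p + 1)))"
  have "y_p p = p powr (1 + - (p / (p + 1)))"
    using assms by (simp add: y_p_def field_simps)
  then have "y_p p = p * q"
    using assms by (simp only: powr_add) (simp add: q_def)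
  moreover have "y_p p powr (- p) = q"
    by (simp add: y_p_def powr_powr q_def)
  ultimately have "omega_fn p (y_p p) = (1 + p) * q"
    by (simp add: omega_fn_def distrib_right)
  then have "omega_fn p (y_p p) powr (p + 1) = (1 + p) powr (p + 1) * q powr (p + 1)"
    using assms by (simp add: powr_mult q_def)
  also have "q powr (p + 1) = p powr (- p)"
    using assms by (simp add: q_def powr_powr)
  also have "(1 + p) powr (p + 1) * p powr (- p) = (1 + p) * ((1 + p) powr p / p powr p)"
    using assms by (simp add: powr_add powr_minus divide_inverse)
  also have "(1 + p) powr p / p powr p = (1 + 1 / p) powr p"
    using assms by (subst powr_divide[symmetric]) (auto simp: add_divide_distrib add.commute)
  finally show ?thesis .
qed

text \<open>\<open>K_p p\<close> is the floor of the real \<open>k\<close> at which the comparison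
  sequence has fallen to \<open>C\<close>; up to it the zero algorithm is accurate enough.\<close>

lemma two_powr_K_p_le:
  assumes p: "p > 0" and k: "k \<le> K_p p"
  shows "2 powr (real k * p) \<le> (2 powr p * omega_fn p (y_p p)) powr (p + 1)"
proof -
  define w where "w = omega_fn p (y_p p)"
  define X where "X = 2 powr (p + 1) * w powr (1 + 1 / p)"
  have w: "w \<ge> 1" unfolding w_def by (rule omega_fn_ge_1[OF p y_p_pos[OF p]])
  \<comment> \<open>Knowing \<open>X \<ge> 1\<close> makes the logarithm nonnegative, so
    \<open>nat\<close> does not truncate it.\<close>
  have "2 powr (p + 1) \<ge> (1::real)" "w powr (1 + 1 / p) \<ge> 1"
    using p w by (auto intro: ge_one_powr_ge_zero)
  then have X: "X \<ge> 1" unfolding X_def by (metis mult_mono mult_1 zero_le_one order_trans)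
  have "real k \<le> real_of_int \<lfloor>log 2 X\<rfloor>"
    using k X unfolding K_p_def X_def[symmetric] w_def[symmetric] by (simp add: le_nat_iff)
  also have "\<dots> \<le> log 2 X" by simp
  finally have "2 powr real k \<le> X"
    using X by (subst (asm) le_log_iff) auto
  then have "(2 powr real k) powr p \<le> X powr p"
    using p by (intro powr_mono2) auto
  also have "X powr p = 2 powr (p * (p + 1)) * w powr ((1 + 1 / p) * p)"
    using w by (simp add: X_def powr_mult powr_powr mult.commute)
  also have "(1 + 1 / p) * p = p + 1" using p by (simp add: field_simps)
  also have "2 powr (p * (p + 1)) * w powr (p + 1) = (2 powr p * w) powr (p + 1)"
    using w by (simp add: powr_mult powr_powr)
  finally show ?thesis by (simp add: powr_powr w_def)
qed

text \<open>The choice of \<open>m\<close> balances the two terms: with \<open>b = a / (C 2\<^sup>k)\<close> both are at most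
  \<open>C b\<^sup>p\<^sup>/\<^sup>(\<^sup>p\<^sup>+\<^sup>1\<^sup>)\<close> times \<open>y\<^sup>-\<^sup>p\<close> and \<open>y\<close>, which sum up to \<open>\<omega>(y)\<close>.\<close>

lemma error_recursion_step:
  fixes k :: nat
  assumes p: "p > 0" and C: "C > 0" and a: "a > 0" and y: "y_p p = y" "\<omega> = omega_fn p y"
    and m: "m = m_choice C p k (sqrt a)"
    and le: "a \<le> C * (2 powr p * \<omega>) powr (p + 1) * 2 powr (- real k * p)"
  shows "C * real (m + 1) powr (- p) + real m / 2 ^ k * a
      \<le> C * (2 powr p * \<omega>) powr (p + 1) * 2 powr (- real (Suc k) * p)"
proof -
  define b where "b = a / (C * 2 ^ k)"
  define X where "X = b powr (- (1 / (p + 1)))"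
  define D where "D = 2 powr p * \<omega>"
  have y0: "y > 0" using y_p_pos[OF p] y(1) by simp
  have \<omega>: "\<omega> \<ge> 1" unfolding y(2) by (rule omega_fn_ge_1[OF p y0])
  have D: "D > 0" using \<omega> by (simp add: D_def)
  have b: "b > 0" using a C by (simp add: b_def)
  have X: "X > 0" using b by (simp add: X_def)
  have "C * 2 ^ k / (sqrt a)\<^sup>2 = inverse b" using a by (simp add: b_def)
  then have "m = nat \<lfloor>X * y\<rfloor>"
    using b by (simp add: m m_choice_def y(1) X_def powr_minus inverse_powr)
  moreover have "X * y > 0" using X y0 by simp
  \<comment> \<open>Rounding costs nothing: \<open>m\<close>, which multiplies the old error, is
    rounded down, while the tail is governed by \<open>m + 1\<close>.\<close>
  ultimately have m1: "real m \<le> X * y" and m2: "X * y \<le> real (m + 1)"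
    by (auto simp: of_nat_nat less_imp_le floor_le_iff) linarith+
  have Xp: "X powr (- p) = b powr (p / (p + 1))"
    by (simp add: X_def powr_powr)
  have "X * b = b powr (- (1 / (p + 1)) + 1)"
    unfolding powr_add X_def using b by simp
  also have "- (1 / (p + 1)) + 1 = p / (p + 1)" using p by (simp add: field_simps)
  finally have Xb: "X * b = b powr (p / (p + 1))" .
  have "real (m + 1) powr (- p) \<le> (X * y) powr (- p)"
    using m2 X y0 p by (intro powr_mono2') auto
  also have "\<dots> = b powr (p / (p + 1)) * y powr (- p)"
    using X y0 by (simp add: powr_mult Xp)
  finally have t1: "C * real (m + 1) powr (- p) \<le> C * (b powr (p / (p + 1)) * y powr (- p))"
    using C by (intro mult_left_mono) auto
  have "real m / 2 ^ k * a = C * (real m * b)" using C by (simp add: b_def)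
  also have "\<dots> \<le> C * (X * y * b)"
    using C b m1 by (intro mult_left_mono mult_right_mono) auto
  also have "X * y * b = b powr (p / (p + 1)) * y" using Xb by (simp add: mult_ac)
  finally have t2: "real m / 2 ^ k * a \<le> C * (b powr (p / (p + 1)) * y)" .
  \<comment> \<open>Dividing the hypothesis by \<open>2 ^ k\<close> turns the exponent
    \<open>- k * p\<close> into \<open>- k * (p + 1)\<close>, so the right side becomes a full power
    \<open>p + 1\<close>, which the exponent \<open>p / (p + 1)\<close> undoes.\<close>
  have "b \<le> D powr (p + 1) * 2 powr (- real k * p) / 2 ^ k"
    using le C by (simp add: b_def D_def field_simps)
  also have "\<dots> = D powr (p + 1) * (2 powr (- real k * p) * 2 powr (- real k))"
    by (simp add: powr_minus powr_realpow divide_inverse mult_ac)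
  also have "2 powr (- real k * p) * 2 powr (- real k) = (2 powr (- real k)) powr (p + 1)"
    by (simp add: powr_powr powr_add[symmetric] algebra_simps)
  also have "D powr (p + 1) * \<dots> = (D * 2 powr (- real k)) powr (p + 1)"
    using D by (simp add: powr_mult)
  finally have "b powr (p / (p + 1)) \<le> ((D * 2 powr (- real k)) powr (p + 1)) powr (p / (p + 1))"
    using b p by (intro powr_mono2) auto
  also have "\<dots> = (D * 2 powr (- real k)) powr p"
    using p by (simp add: powr_powr)
  also have "\<dots> = D powr p * 2 powr (- real k * p)"
    using D by (simp add: powr_mult powr_powr)
  finally have bp: "b powr (p / (p + 1)) \<le> D powr p * 2 powr (- real k * p)" .
  have "C * real (m + 1) powr (- p) + real m / 2 ^ k * a \<le> C * \<omega> * b powr (p / (p + 1))"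
    using t1 t2 by (simp add: y(2) omega_fn_def algebra_simps)
  also have "\<dots> \<le> C * \<omega> * (D powr p * 2 powr (- real k * p))"
    using C \<omega> bp by (intro mult_left_mono) auto
  \<comment> \<open>\<open>\<omega> = D * 2 powr (- p)\<close> supplies the missing factor
    \<open>D\<close> and the factor that advances \<open>k\<close> to \<open>Suc k\<close>.\<close>
  also have "\<dots> = C * (D powr p * (D * 2 powr (- p))) * 2 powr (- real k * p)"
    by (simp add: D_def powr_minus field_simps)
  also have "\<dots> = C * D powr (p + 1) * (2 powr (- p) * 2 powr (- real k * p))"
    using D by (simp add: powr_add mult_ac)
  also have "2 powr (- p) * 2 powr (- real k * p) = 2 powr (- real (Suc k) * p)"
    by (simp add: powr_add[symmetric] algebra_simps)
  finally show ?thesis by (simp add: D_def)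
qed

text \<open>Up to \<open>K_p p\<close> the comparison sequence is still at least \<open>C\<close>;
  beyond it each step reproduces the sequence. Indices stop at \<open>\<kappa>\<close> because the
  sample points are prescribed only that far.\<close>

lemma error_recursion:
  assumes p: "p > 0" and C: "C > 0"
    and tail: "\<And>n. tail n \<le> C * real (n + 1) powr (- p)"
    and pos: "\<And>k. k \<le> \<kappa> \<Longrightarrow> a k > 0"
    and init: "\<And>k. k \<le> K_p p \<Longrightarrow> a k \<le> C"
    and step: "\<And>k. K_p p \<le> k \<Longrightarrow> k < \<kappa> \<Longrightarrow>
        a (Suc k) \<le> tail (m_choice C p k (sqrt (a k))) + real (m_choice C p k (sqrt (a k))) / 2 ^ k * a k"
    and k: "k \<le> \<kappa>"
  shows "a k \<le> C * (2 powr p * omega_fn p (y_p p)) powr (p + 1) * 2 powr (- real k * p)"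
  using k
proof (induction k)
  case 0
  have "a 0 \<le> C * 1" using init by simp
  also have "\<dots> \<le> C * (2 powr p * omega_fn p (y_p p)) powr (p + 1)"
    using two_powr_K_p_le[OF p, of 0] C by (intro mult_left_mono) auto
  finally show ?case by simp
next
  case (Suc k)
  show ?case
  proof (cases "Suc k \<le> K_p p")
    case True
    have "a (Suc k) \<le> C * (2 powr (real (Suc k) * p) * 2 powr (- real (Suc k) * p))"
      using init[OF True] by (simp only: mult_minus_left powr_minus) simp
    also have "\<dots> \<le> C * ((2 powr p * omega_fn p (y_p p)) powr (p + 1) * 2 powr (- real (Suc k) * p))"
      using two_powr_K_p_le[OF p True] C by (intro mult_left_mono mult_right_mono) auto
    finally show ?thesis by (simp add: mult.assoc)
  next
    case False
    let ?m = "m_choice C p k (sqrt (a k))"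
    have "a (Suc k) \<le> tail ?m + real ?m / 2 ^ k * a k"
      using False Suc.prems by (intro step) auto
    also have "\<dots> \<le> C * real (?m + 1) powr (- p) + real ?m / 2 ^ k * a k"
      using tail[of ?m] by simp
    also have "\<dots> \<le> C * (2 powr p * omega_fn p (y_p p)) powr (p + 1) * 2 powr (- real (Suc k) * p)"
      using Suc by (intro error_recursion_step[OF p C pos refl refl refl]) auto
    finally show ?thesis .
  qed
qed

text \<open>\<open>N \<ge> 2\<close> makes the floor of the logarithm at least 1, so the natural
  subtraction in \<open>kappa\<close> is exact. The first bound counts nodes, the second converts
  the rate into powers of \<open>N\<close>.\<close>

lemma kappa_bounds:
  assumes "N \<ge> 2"
  shows "2 ^ Suc (kappa N) \<le> N" and "N < 2 ^ (kappa N + 2)"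
proof -
  have l1: "1 \<le> log 2 (real N)" using assms by (simp add: le_log_iff)
  then have f: "\<lfloor>log 2 (real N)\<rfloor> = int (kappa N + 1)"
    by (simp add: kappa_def le_floor_iff of_nat_diff nat_le_iff)
  have "real (kappa N + 1) \<le> log 2 (real N)" "log 2 (real N) < real (kappa N + 1) + 1"
    using f by linarith+
  then have "2 powr real (kappa N + 1) \<le> real N" "real N < 2 powr real (kappa N + 2)"
    using assms by (auto simp: le_log_iff log_less_iff)
  then have "real (2 ^ Suc (kappa N)) \<le> real N" "real N < real (2 ^ (kappa N + 2))"
    by (auto simp: powr_realpow[symmetric] powr_add)
  then show "2 ^ Suc (kappa N) \<le> N" "N < 2 ^ (kappa N + 2)"
    by (simp_all only: of_nat_le_iff of_nat_less_iff)
qed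

text \<open>Replacing the dyadic index by \<open>N\<close> costs
  \<open>2 powr (2 * (p + 1))\<close>, which joins \<open>2 powr (p * (p + 1))\<close> to form the
  leading constant.\<close>

lemma final_constant:
  assumes p: "p > 0" and C: "C > 0" and N: "N \<ge> 2"
  shows "1 / 2 ^ kappa N * (C * (2 powr p * omega_fn p (y_p p)) powr (p + 1) * 2 powr (- real (kappa N) * p))
     \<le> 2 powr ((p + 2) * (p + 1)) * (1 + p) * (1 + 1 / p) powr p * C * (1 / real N powr (p + 1))"
proof -
  define w where "w = omega_fn p (y_p p)"
  define \<kappa> where "\<kappa> = real (kappa N)"
  have w: "w \<ge> 1" unfolding w_def by (rule omega_fn_ge_1[OF p y_p_pos[OF p]])
  have "real N \<le> real (2 ^ (kappa N + 2))"
    using kappa_bounds(2)[OF N] by (simp only: of_nat_le_iff)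
  also have "\<dots> = 2 powr (\<kappa> + 2)"
    by (simp add: powr_realpow[symmetric] powr_add \<kappa>_def)
  finally have "real N powr (p + 1) \<le> (2 powr (\<kappa> + 2)) powr (p + 1)"
    using p by (intro powr_mono2) auto
  then have "real N powr (p + 1) \<le> 2 powr (2 * (p + 1)) * 2 powr (\<kappa> * (p + 1))"
    by (simp add: powr_powr powr_add[symmetric] algebra_simps)
  then have main: "2 powr (- \<kappa> * (p + 1)) \<le> 2 powr (2 * (p + 1)) * (1 / real N powr (p + 1))"
    using N unfolding mult_minus_left powr_minus by (simp add: divide_simps mult.commute)
  have const: "(2 powr p * w) powr (p + 1) = 2 powr (p * (p + 1)) * ((1 + p) * (1 + 1 / p) powr p)"
    using w omega_fn_y_p_powr[OF p] by (simp add: powr_mult powr_powr w_def)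
  have "1 / 2 ^ kappa N = 2 powr (- \<kappa>)"
    by (simp add: \<kappa>_def powr_minus powr_realpow divide_inverse)
  then have "1 / 2 ^ kappa N * (C * (2 powr p * w) powr (p + 1) * 2 powr (- \<kappa> * p))
     = C * (2 powr p * w) powr (p + 1) * (2 powr (- \<kappa>) * 2 powr (- \<kappa> * p))" by simp
  also have "2 powr (- \<kappa>) * 2 powr (- \<kappa> * p) = 2 powr (- \<kappa> * (p + 1))"
    by (simp add: powr_add[symmetric] algebra_simps)
  also have "C * (2 powr p * w) powr (p + 1) * 2 powr (- \<kappa> * (p + 1))
     \<le> C * (2 powr p * w) powr (p + 1) * (2 powr (2 * (p + 1)) * (1 / real N powr (p + 1)))"
    using C main by (intro mult_left_mono) auto
  also have "\<dots> = (2 powr (p * (p + 1)) * 2 powr (2 * (p + 1))) * (1 + p) * (1 + 1 / p) powr p * C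
      * (1 / real N powr (p + 1))"
    unfolding const by simp
  also have "2 powr (p * (p + 1)) * 2 powr (2 * (p + 1)) = 2 powr ((p + 2) * (p + 1))"
    by (simp add: powr_add[symmetric] algebra_simps)
  finally show ?thesis by (simp add: w_def \<kappa>_def)
qed

section \<open>Gaussian measures with reproducing kernel covariance\<close>

lemma unit_cube_eq_cbox: "unit_cube = cbox 0 (1 :: real^'d)"
  by (auto simp: unit_cube_def mem_box_cart)

lemma finite_measure_unit_cube: "finite_measure (lebesgue_on (unit_cube :: (real^'d) set))"
  unfolding unit_cube_eq_cbox by (intro finite_measure_lebesgue_on) simp

lemma is_L2_iff_sq_integrable: "is_L2 f \<longleftrightarrow> sq_integrable (lebesgue_on unit_cube) f"
  by (simp add: is_L2_def sq_integrable_def)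

locale rkhs_gaussian =
  fixes K :: "real^'d \<Rightarrow> real^'d \<Rightarrow> real"
    and kv :: "real^'d \<Rightarrow> 'h::{real_inner,complete_space}"
    and lam :: "nat \<Rightarrow> real" and eta :: "nat \<Rightarrow> 'h"
    and evb :: "'b::banach \<Rightarrow> real^'d \<Rightarrow> real" and \<mu> :: "'b measure"
  assumes rkhs: "rkhs_setting K kv lam eta"
    and banach: "banach_setting K kv evb \<mu>"
begin

abbreviation cube :: "(real^'d) measure" where
  "cube \<equiv> lebesgue_on unit_cube"

lemmas rkhs_conjuncts = rkhs[unfolded rkhs_setting_def is_L2_iff_sq_integrable]

lemma kernel_eq:
  "x \<in> unit_cube \<Longrightarrow> y \<in> unit_cube \<Longrightarrow> K x y = inner (kv x) (kv y)"
  using rkhs_conjuncts[THEN conjunct1] by blast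

lemma kernel_diag_integrable:
  "integrable cube (\<lambda>x. K x x)"
  by (rule rkhs_conjuncts[THEN conjunct2, THEN conjunct2, THEN conjunct2, THEN conjunct1])

lemma rkhs_sq_integrable:
  "sq_integrable cube (rkhs_fun kv h)"
  using rkhs_conjuncts[THEN conjunct2, THEN conjunct2, THEN conjunct2, THEN conjunct2, THEN conjunct1] by blast

lemma lam_pos:
  "j \<ge> 1 \<Longrightarrow> lam j > 0"
  using rkhs_conjuncts[THEN conjunct2, THEN conjunct2, THEN conjunct2, THEN conjunct2, THEN conjunct2, THEN conjunct2, THEN conjunct1] by blast

lemma eigen_eq:
  "j \<ge> 1 \<Longrightarrow> x \<in> unit_cube \<Longrightarrow>
    cube_int (\<lambda>y. rkhs_fun kv (eta j) y * K x y) = lam j * rkhs_fun kv (eta j) x"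
  using rkhs_conjuncts[THEN conjunct2, THEN conjunct2, THEN conjunct2, THEN conjunct2, THEN conjunct2, THEN conjunct2, THEN conjunct2, THEN conjunct1] by blast

lemma eta_orthonormal:
  "i \<ge> 1 \<Longrightarrow> j \<ge> 1 \<Longrightarrow> inner (eta i) (eta j) = (if i = j then 1 else 0)"
  using rkhs_conjuncts[THEN conjunct2, THEN conjunct2, THEN conjunct2, THEN conjunct2, THEN conjunct2, THEN conjunct2, THEN conjunct2, THEN conjunct2, THEN conjunct1] by blast

lemma span_eta_dense:
  "closure (span (eta ` {1..})) = UNIV"
  by (rule rkhs_conjuncts[THEN conjunct2, THEN conjunct2, THEN conjunct2, THEN conjunct2, THEN conjunct2, THEN conjunct2, THEN conjunct2, THEN conjunct2, THEN conjunct2, THEN conjunct1])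

lemma eta_L2_orthogonal:
  "i \<ge> 1 \<Longrightarrow> j \<ge> 1 \<Longrightarrow>
    L2_inner (rkhs_fun kv (eta i)) (rkhs_fun kv (eta j)) = (if i = j then lam j else 0)"
  using rkhs_conjuncts[THEN conjunct2, THEN conjunct2, THEN conjunct2, THEN conjunct2, THEN conjunct2, THEN conjunct2, THEN conjunct2, THEN conjunct2, THEN conjunct2, THEN conjunct2] by blast

lemmas banach_conjuncts = banach[unfolded banach_setting_def is_L2_iff_sq_integrable centered_gaussian_def]

lemma separable_B:
  "separable_space TYPE('b)"
  by (rule banach_conjuncts[THEN conjunct1])

lemma evb_linear:
  "linear (\<lambda>f. evb f x)"
  using banach_conjuncts[THEN conjunct2, THEN conjunct1] by (rule spec)

lemma evb_sq_integrable:
  "sq_integrable cube (evb f)"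
  using banach_conjuncts[THEN conjunct2, THEN conjunct2, THEN conjunct2, THEN conjunct2, THEN conjunct1] by (rule spec)

lemma prob_space_\<mu>:
  "prob_space \<mu>"
  using banach_conjuncts[THEN conjunct2, THEN conjunct2, THEN conjunct2, THEN conjunct2, THEN conjunct2, THEN conjunct2, THEN conjunct1] by (rule conjunct1)

lemma sets_\<mu>:
  "sets \<mu> = sets borel"
  using banach_conjuncts[THEN conjunct2, THEN conjunct2, THEN conjunct2, THEN conjunct2, THEN conjunct2, THEN conjunct2, THEN conjunct1, THEN conjunct2] by (rule conjunct1)

lemma evb_mult_integrable:
  "x \<in> unit_cube \<Longrightarrow> y \<in> unit_cube \<Longrightarrow> integrable \<mu> (\<lambda>f. evb f x * evb f y)"
  using banach_conjuncts[THEN conjunct2, THEN conjunct2, THEN conjunct2, THEN conjunct2, THEN conjunct2, THEN conjunct2, THEN conjunct2] by blast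

lemma covariance:
  "x \<in> unit_cube \<Longrightarrow> y \<in> unit_cube \<Longrightarrow> (\<integral>f. evb f x * evb f y \<partial>\<mu>) = K x y"
  using banach_conjuncts[THEN conjunct2, THEN conjunct2, THEN conjunct2, THEN conjunct2, THEN conjunct2, THEN conjunct2, THEN conjunct2] by simp

sublocale \<mu>: prob_space \<mu> by (rule prob_space_\<mu>)
sublocale cube: finite_measure cube by (rule finite_measure_unit_cube)
sublocale pair_sigma_finite cube \<mu> ..

lemma space_\<mu> [simp]: "space \<mu> = UNIV"
  using sets_eq_imp_space_eq[OF sets_\<mu>] by simp

lemma evb_bounded_linear:
  assumes "x \<in> unit_cube"
  shows "bounded_linear (\<lambda>f. evb f x)"
proof (rule borel_linear_imp_bounded_linear[OF evb_linear])
  fix n :: nat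
  \<comment> \<open>The covariance hypothesis yields measurability of the square of the evaluation;
    its sublevel sets are the symmetric sets required by the continuity lemma.\<close>
  have [measurable]: "(\<lambda>f. evb f x * evb f x) \<in> borel_measurable \<mu>"
    using evb_mult_integrable[OF assms assms] by simp
  have "{f \<in> space \<mu>. evb f x * evb f x \<le> (real n)\<^sup>2} \<in> sets \<mu>" by measurable
  moreover have "\<bar>a\<bar> \<le> real n \<longleftrightarrow> a * a \<le> (real n)\<^sup>2" for a
    using abs_le_square_iff[of a "real n"] by (simp add: power2_eq_square)
  ultimately show "{f. \<bar>evb f x\<bar> \<le> real n} \<in> sets borel"
    using sets_\<mu> by simp
qed

section \<open>Joint measurability and square integrability of the evaluation map\<close>

lemma evb_joint_measurable: "case_prod (\<lambda>x f. evb f x) \<in> borel_measurable (cube \<Otimes>\<^sub>M \<mu>)"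
proof (rule borel_measurable_Caratheodory[OF separable_B _ _ sets_\<mu>])
  show "continuous_on UNIV (\<lambda>f. evb f x)" if "x \<in> space cube" for x
    using evb_bounded_linear that by (simp add: linear_continuous_on)
  show "evb f \<in> borel_measurable cube" for f
    using evb_sq_integrable by (rule sq_integrableD)
qed

lemma evb_point_sq_integrable:
  assumes "x \<in> unit_cube"
  shows "sq_integrable \<mu> (\<lambda>f. evb f x)"
proof -
  have "(\<lambda>f. evb f x) \<in> borel_measurable borel"
    using evb_bounded_linear[OF assms]
    by (intro borel_measurable_continuous_onI linear_continuous_on)
  then have "(\<lambda>f. evb f x) \<in> borel_measurable \<mu>"
    using measurable_cong_sets[OF sets_\<mu> refl] by blast
  then show ?thesis
    using evb_mult_integrable[OF assms assms] by (simp add: sq_integrable_def power2_eq_square)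
qed

text \<open>For fixed \<open>x\<close> the second moment is \<open>K x x\<close>, and the kernel has
  finite trace.\<close>

lemma evb_joint_sq_integrable: "sq_integrable (cube \<Otimes>\<^sub>M \<mu>) (case_prod (\<lambda>x f. evb f x))"
proof -
  have "integrable (cube \<Otimes>\<^sub>M \<mu>) (case_prod (\<lambda>x f. (evb f x)\<^sup>2))"
  proof (rule Fubini_integrable)
    show "case_prod (\<lambda>x f. (evb f x)\<^sup>2) \<in> borel_measurable (cube \<Otimes>\<^sub>M \<mu>)"
      using borel_measurable_power[OF evb_joint_measurable, of 2] by (simp add: case_prod_unfold)
    have "integrable cube (\<lambda>x. \<integral>f. norm ((evb f x)\<^sup>2) \<partial>\<mu>) \<longleftrightarrow> integrable cube (\<lambda>x. K x x)"
      by (rule Bochner_Integration.integrable_cong) (auto simp: covariance[symmetric] power2_eq_square)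
    then show "integrable cube (\<lambda>x. \<integral>f. norm (case (x, f) of (x, f) \<Rightarrow> (evb f x)\<^sup>2) \<partial>\<mu>)"
      using kernel_diag_integrable by simp
    show "AE x in cube. integrable \<mu> (\<lambda>f. case (x, f) of (x, f) \<Rightarrow> (evb f x)\<^sup>2)"
      using evb_point_sq_integrable by (intro AE_I2) (auto simp: sq_integrable_def)
  qed
  then show ?thesis
    using evb_joint_measurable by (simp add: sq_integrable_def case_prod_unfold)
qed

section \<open>Eigenfunction coefficients as random variables\<close>

abbreviation eigfun :: "nat \<Rightarrow> real^'d \<Rightarrow> real" where
  "eigfun j \<equiv> rkhs_fun kv (eta j)"

text \<open>The second moment of \<open>coef j\<close> is \<open>(lam j)\<^sup>2\<close>, so
  division by \<open>lam j\<close> gives the orthonormal random variables that represent the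
  basis.\<close>

definition coef :: "nat \<Rightarrow> 'b \<Rightarrow> real" where
  "coef j f = (\<integral>x. eigfun j x * evb f x \<partial>cube)"

lemma L2_inner_evb_sq_integrable:
  assumes "sq_integrable cube g"
  shows "sq_integrable \<mu> (\<lambda>f. \<integral>x. g x * evb f x \<partial>cube)"
  by (rule sq_integrable_partial_integral[OF _ _ evb_joint_sq_integrable _ assms])
     (auto intro: evb_sq_integrable cube.sigma_finite_measure_axioms \<mu>.finite_measure_axioms)

lemma coef_sq_integrable: "sq_integrable \<mu> (coef j)"
  unfolding coef_def[abs_def] by (rule L2_inner_evb_sq_integrable[OF rkhs_sq_integrable])

text \<open>After Fubini the inner expectation is the kernel, and the eigen equation evaluates the
  remaining integral.\<close>

lemma expectation_coef_evb:
  assumes "j \<ge> 1" "x \<in> unit_cube"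
  shows "(\<integral>f. coef j f * evb f x \<partial>\<mu>) = lam j * eigfun j x"
proof -
  have "(\<integral>f. coef j f * evb f x \<partial>\<mu>) = (\<integral>f. evb f x * (\<integral>y. eigfun j y * evb f y \<partial>cube) \<partial>\<mu>)"
    by (simp add: coef_def mult.commute)
  also have "\<dots> = (\<integral>y. eigfun j y * (\<integral>f. evb f x * evb f y \<partial>\<mu>) \<partial>cube)"
    by (rule integral_swap_tensor(3)[OF evb_joint_sq_integrable rkhs_sq_integrable
          evb_point_sq_integrable[OF assms(2)]])
  also have "\<dots> = (\<integral>y. eigfun j y * K x y \<partial>cube)"
    by (rule Bochner_Integration.integral_cong) (auto simp: covariance assms)
  also have "\<dots> = lam j * eigfun j x"
    using eigen_eq[OF assms] by (simp add: cube_int_def)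
  finally show ?thesis .
qed

lemma expectation_coef_integral:
  assumes "j \<ge> 1" and g: "sq_integrable cube g"
  shows "(\<integral>f. coef j f * (\<integral>x. g x * evb f x \<partial>cube) \<partial>\<mu>) = lam j * (\<integral>x. g x * eigfun j x \<partial>cube)"
proof -
  have "(\<integral>f. coef j f * (\<integral>x. g x * evb f x \<partial>cube) \<partial>\<mu>) = (\<integral>x. g x * (\<integral>f. coef j f * evb f x \<partial>\<mu>) \<partial>cube)"
    by (rule integral_swap_tensor(3)[OF evb_joint_sq_integrable g coef_sq_integrable])
  also have "\<dots> = (\<integral>x. lam j * (g x * eigfun j x) \<partial>cube)"
    by (rule Bochner_Integration.integral_cong) (auto simp: expectation_coef_evb[OF assms(1)])
  finally show ?thesis by simp
qed

lemma expectation_coef_coef: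
  assumes "i \<ge> 1" "j \<ge> 1"
  shows "(\<integral>f. coef i f * coef j f \<partial>\<mu>) = (if i = j then (lam i)\<^sup>2 else 0)"
  using expectation_coef_integral[OF assms(1) rkhs_sq_integrable, of "eta j"]
    eta_L2_orthogonal[OF assms(2,1)]
  by (simp add: coef_def L2_inner_def cube_int_def power2_eq_square)

lemma rkhs_integrable: "integrable cube (rkhs_fun kv h)"
  using sq_integrable_mult[OF rkhs_sq_integrable cube.sq_integrable_const, of h 1] by simp

text \<open>Orthonormality makes \<open>eta\<close> injective, so combinations indexed by vectors
  can be reindexed by integers.\<close>

lemma span_eta_representation:
  assumes "h \<in> span (eta ` {1..})"
  obtains J c where "finite J" "J \<subseteq> {1..}" "h = (\<Sum>j\<in>J. c j *\<^sub>R eta j)"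
proof -
  have inj: "inj_on eta {1..}"
  proof (rule inj_onI)
    fix i j :: nat assume "i \<in> {1..}" "j \<in> {1..}" and eq: "eta i = eta j"
    then have "(if i = j then 1 else 0 :: real) = 1"
      using eta_orthonormal[of i j] eta_orthonormal[of j j] by simp
    then show "i = j" by (simp split: if_splits)
  qed
  obtain T r where T: "finite T" "T \<subseteq> eta ` {1..}" "h = (\<Sum>v\<in>T. r v *\<^sub>R v)"
    using assms unfolding span_explicit by auto
  obtain J where J: "J \<subseteq> {1..}" "finite J" "T = eta ` J"
    using finite_subset_image[OF T(1,2)] by blast
  have "h = (\<Sum>j\<in>J. r (eta j) *\<^sub>R eta j)"
    unfolding T(3) J(3) by (subst sum.reindex) (auto intro: inj_on_subset[OF inj J(1)])
  with J show ?thesis by (intro that)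
qed

text \<open>A finite combination \<open>h = \<Sum> c\<^sub>j \<eta>\<^sub>j\<close> is represented by the random variable
  \<open>Y = \<Sum> c\<^sub>j \<langle>f, \<eta>\<^sub>j\<rangle> / \<lambda>\<^sub>j\<close> in the sense that \<open>h(x) = E[Y f(x)]\<close> and \<open>E[Y\<^sup>2] = \<parallel>h\<parallel>\<^sup>2\<close>; hence the error at \<open>h\<close> is \<open>E[Y Z]\<close>
  for the error functional \<open>Z\<close>, and Cauchy--Schwarz applies.\<close>

lemma ewor_le_eavg_int:
  assumes S: "finite S" "S \<subseteq> unit_cube" and Q: "\<And>f. Q f = (\<Sum>t\<in>S. w t * f t)"
  shows "0 \<le> ewor kv Q" and "ewor kv Q \<le> eavg_int evb \<mu> Q"
proof -
  define err where "err h = cube_int (rkhs_fun kv h) - Q (rkhs_fun kv h)" for h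
  define Z where "Z f = cube_int (evb f) - Q (evb f)" for f
  have Z_eq: "Z = (\<lambda>f. (\<integral>x. 1 * evb f x \<partial>cube) - (\<Sum>t\<in>S. w t * evb f t))"
    by (simp add: Z_def Q cube_int_def fun_eq_iff)
  have pt: "sq_integrable \<mu> (\<lambda>f. evb f t)" if "t \<in> S" for t
    using evb_point_sq_integrable S(2) that by blast
  have sums: "sq_integrable \<mu> (\<lambda>f. \<Sum>t\<in>S. w t * evb f t)"
    by (intro sq_integrable_sum sq_integrable_cmult pt)
  have ints: "sq_integrable \<mu> (\<lambda>f. \<integral>x. 1 * evb f x \<partial>cube)"
    by (rule L2_inner_evb_sq_integrable[OF cube.sq_integrable_const])
  have Z: "sq_integrable \<mu> Z"
    unfolding Z_eq by (rule sq_integrable_diff[OF ints sums])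
  \<comment> \<open>Pairing with \<open>coef j\<close> turns both the integral and the node values
    of \<open>f\<close> into \<open>lam j\<close> times those of the eigenfunction.\<close>
  have coef_Z: "(\<integral>f. coef j f * Z f \<partial>\<mu>) = lam j * err (eta j)" if j: "j \<ge> 1" for j
  proof -
    have "(\<integral>f. coef j f * Z f \<partial>\<mu>) = (\<integral>f. coef j f * (\<integral>x. 1 * evb f x \<partial>cube)
        - (\<Sum>t\<in>S. w t * (coef j f * evb f t)) \<partial>\<mu>)"
      unfolding Z_eq by (intro Bochner_Integration.integral_cong refl)
        (simp add: right_diff_distrib sum_distrib_left mult.left_commute)
    also have "\<dots> = (\<integral>f. coef j f * (\<integral>x. 1 * evb f x \<partial>cube) \<partial>\<mu>)
        - (\<Sum>t\<in>S. w t * (\<integral>f. coef j f * evb f t \<partial>\<mu>))"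
      using sq_integrable_mult[OF coef_sq_integrable ints] sq_integrable_mult[OF coef_sq_integrable pt]
      by (subst Bochner_Integration.integral_diff) (auto simp: Bochner_Integration.integral_sum)
    also have "\<dots> = lam j * (\<integral>x. 1 * eigfun j x \<partial>cube) - (\<Sum>t\<in>S. w t * (lam j * eigfun j t))"
      using S(2) expectation_coef_integral[OF j cube.sq_integrable_const[of 1]]
      by (intro arg_cong2[where f = "(-)"] sum.cong refl) (auto simp: expectation_coef_evb[OF j])
    also have "\<dots> = lam j * err (eta j)"
      by (simp add: err_def Q cube_int_def right_diff_distrib sum_distrib_left mult.left_commute)
    finally show ?thesis .
  qed
  have err_add: "err (x + y) = err x + err y" for x y
    using rkhs_integrable[of x] rkhs_integrable[of y]
    by (simp add: err_def Q cube_int_def rkhs_fun_def inner_add_left sum.distrib distrib_left)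
  have err_scale: "err (c *\<^sub>R x) = c *\<^sub>R err x" for c x
    by (simp add: err_def Q cube_int_def rkhs_fun_def right_diff_distrib sum_distrib_left mult.left_commute)
  \<comment> \<open>A crude bound suffices: only continuity is wanted, to pass from the span to its
    closure. Replacing \<open>norm (kv x)\<close> by \<open>1 + K x x\<close> leads to an integrable
    majorant.\<close>
  have err_bound: "norm (err h) \<le> norm h * ((\<integral>x. 1 + K x x \<partial>cube) + (\<Sum>t\<in>S. \<bar>w t\<bar> * norm (kv t)))" for h
  proof -
    have "\<bar>cube_int (rkhs_fun kv h)\<bar> \<le> (\<integral>x. norm h * (1 + K x x) \<partial>cube)"
      unfolding cube_int_def
    proof (rule integral_abs_bound_integral)
      show "integrable cube (\<lambda>x. norm h * (1 + K x x))" using kernel_diag_integrable by simp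
      fix x assume "x \<in> space cube"
      then have "K x x = (norm (kv x))\<^sup>2" by (simp add: kernel_eq power2_norm_eq_inner)
      moreover have "norm (kv x) \<le> 1 + (norm (kv x))\<^sup>2"
        using zero_le_power2[of "norm (kv x) - 1/2"] by (simp add: power2_diff power_one_over)
      ultimately have "norm (kv x) \<le> 1 + K x x" by simp
      moreover have "\<bar>rkhs_fun kv h x\<bar> \<le> norm h * norm (kv x)"
        unfolding rkhs_fun_def by (rule Cauchy_Schwarz_ineq2)
      ultimately show "\<bar>rkhs_fun kv h x\<bar> \<le> norm h * (1 + K x x)"
        by (meson mult_left_mono norm_ge_zero order_trans)
    qed (rule rkhs_integrable)
    moreover have "\<bar>Q (rkhs_fun kv h)\<bar> \<le> (\<Sum>t\<in>S. norm h * (\<bar>w t\<bar> * norm (kv t)))"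
      unfolding Q
    proof (rule order_trans[OF sum_abs], rule sum_mono)
      fix t
      have "\<bar>w t\<bar> * \<bar>inner h (kv t)\<bar> \<le> \<bar>w t\<bar> * (norm h * norm (kv t))"
        by (intro mult_left_mono Cauchy_Schwarz_ineq2) simp
      then show "\<bar>w t * rkhs_fun kv h t\<bar> \<le> norm h * (\<bar>w t\<bar> * norm (kv t))"
        by (simp add: rkhs_fun_def abs_mult mult.left_commute)
    qed
    ultimately have "\<bar>cube_int (rkhs_fun kv h)\<bar> + \<bar>Q (rkhs_fun kv h)\<bar>
        \<le> norm h * (\<integral>x. 1 + K x x \<partial>cube) + norm h * (\<Sum>t\<in>S. \<bar>w t\<bar> * norm (kv t))"
      by (simp only: integral_mult_right_zero sum_distrib_left add_mono)
    then show ?thesis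
      unfolding err_def distrib_left real_norm_def by (rule order_trans[OF abs_triangle_ineq4])
  qed
  have err_bl: "bounded_linear err"
    by (rule bounded_linear_intro[OF err_add err_scale err_bound])
  have eavg: "eavg_int evb \<mu> Q = sqrt (\<integral>f. (Z f)\<^sup>2 \<partial>\<mu>)"
    by (simp add: eavg_int_def Z_def)
  have span_bound: "\<bar>err h\<bar> \<le> norm h * eavg_int evb \<mu> Q" if h_span: "h \<in> span (eta ` {1..})" for h
  proof -
    obtain J c where J: "finite J" "J \<subseteq> {1..}" and h: "h = (\<Sum>j\<in>J. c j *\<^sub>R eta j)"
      using span_eta_representation[OF h_span] .
    define Y where "Y f = (\<Sum>j\<in>J. c j / lam j * coef j f)" for f
    have Y: "sq_integrable \<mu> Y"
      unfolding Y_def[abs_def] by (intro sq_integrable_sum sq_integrable_cmult coef_sq_integrable)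
    have J1: "j \<ge> 1" "lam j \<noteq> 0" if "j \<in> J" for j
      using J(2) that lam_pos[of j] by auto
    have "(\<integral>f. Y f * Z f \<partial>\<mu>) = (\<integral>f. (\<Sum>j\<in>J. c j / lam j * (coef j f * Z f)) \<partial>\<mu>)"
      by (simp add: Y_def sum_distrib_right mult.assoc)
    also have "\<dots> = (\<Sum>j\<in>J. c j / lam j * (\<integral>f. coef j f * Z f \<partial>\<mu>))"
      using sq_integrable_mult[OF coef_sq_integrable Z] by (subst Bochner_Integration.integral_sum) auto
    also have "\<dots> = (\<Sum>j\<in>J. c j * err (eta j))"
      using coef_Z[OF J1(1)] J1(2) by (intro sum.cong refl) simp
    also have "\<dots> = err h"
      unfolding h using bounded_linear.linear[OF err_bl] by (simp add: linear_sum linear_scale)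
    finally have YZ: "(\<integral>f. Y f * Z f \<partial>\<mu>) = err h" .
    have "(\<integral>f. (Y f)\<^sup>2 \<partial>\<mu>) = (\<integral>f. (\<Sum>i\<in>J. \<Sum>j\<in>J. c i / lam i * (c j / lam j) * (coef i f * coef j f)) \<partial>\<mu>)"
      by (simp add: Y_def power2_eq_square sum_product mult_ac)
    also have "\<dots> = (\<Sum>i\<in>J. \<Sum>j\<in>J. c i / lam i * (c j / lam j) * (\<integral>f. coef i f * coef j f \<partial>\<mu>))"
      using sq_integrable_mult[OF coef_sq_integrable coef_sq_integrable]
      by (simp add: Bochner_Integration.integral_sum)
    also have "\<dots> = (\<Sum>i\<in>J. \<Sum>j\<in>J. if i = j then (c i)\<^sup>2 else 0)"
      by (intro sum.cong refl) (auto simp: expectation_coef_coef[OF J1(1) J1(1)] J1(2) power2_eq_square)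
    also have "\<dots> = (\<Sum>i\<in>J. (c i)\<^sup>2)" using J(1) by simp
    finally have YY: "(\<integral>f. (Y f)\<^sup>2 \<partial>\<mu>) = (\<Sum>i\<in>J. (c i)\<^sup>2)" .
    have "(norm h)\<^sup>2 = (\<Sum>i\<in>J. \<Sum>j\<in>J. c i * c j * inner (eta i) (eta j))"
      unfolding h power2_norm_eq_inner by (simp add: inner_sum_left inner_sum_right mult_ac sum_distrib_left inner_commute)
    also have "\<dots> = (\<Sum>i\<in>J. \<Sum>j\<in>J. if i = j then (c i)\<^sup>2 else 0)"
      by (intro sum.cong refl) (auto simp: eta_orthonormal[OF J1(1) J1(1)] power2_eq_square)
    also have "\<dots> = (\<Sum>i\<in>J. (c i)\<^sup>2)" using J(1) by simp
    finally have "(err h)\<^sup>2 \<le> (norm h)\<^sup>2 * (\<integral>f. (Z f)\<^sup>2 \<partial>\<mu>)"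
      using Cauchy_Schwarz_integral[OF Y Z] YZ YY by simp
    then have "sqrt ((err h)\<^sup>2) \<le> sqrt ((norm h)\<^sup>2 * (\<integral>f. (Z f)\<^sup>2 \<partial>\<mu>))"
      by (rule real_sqrt_le_mono)
    then show ?thesis by (simp add: eavg real_sqrt_mult)
  qed
  have all_bound: "\<bar>err h\<bar> \<le> norm h * eavg_int evb \<mu> Q" for h
  proof -
    have "closed {h. \<bar>err h\<bar> \<le> norm h * eavg_int evb \<mu> Q}"
      by (intro closed_Collect_le continuous_intros linear_continuous_on[OF err_bl])
    then have "closure (span (eta ` {1..})) \<subseteq> {h. \<bar>err h\<bar> \<le> norm h * eavg_int evb \<mu> Q}"
      using span_bound by (intro closure_minimal) auto
    then show ?thesis using span_eta_dense by blast
  qed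
  have nonneg: "0 \<le> eavg_int evb \<mu> Q" by (simp add: eavg)
  have unit_bound: "\<bar>err h\<bar> \<le> eavg_int evb \<mu> Q" if "norm h \<le> 1" for h
    using order_trans[OF all_bound mult_right_mono[OF that nonneg]] by simp
  have ewor: "ewor kv Q = (SUP h\<in>{h. norm h \<le> 1}. \<bar>err h\<bar>)"
    by (simp add: ewor_def err_def)
  show "ewor kv Q \<le> eavg_int evb \<mu> Q"
    unfolding ewor
  proof (rule cSUP_least)
    show "{h :: 'h. norm h \<le> 1} \<noteq> {}" by (auto intro: exI[of _ 0])
  qed (simp add: unit_bound)
  \<comment> \<open>Nonnegativity is needed when the inequality is squared. The supremum dominates
    the value at 0 because it is taken over a bounded set.\<close>
  have "0 \<le> \<bar>err 0\<bar>" by simp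
  also have "\<bar>err 0\<bar> \<le> ewor kv Q"
    unfolding ewor
    by (rule cSUP_upper) (auto intro!: bdd_aboveI[of _ "eavg_int evb \<mu> Q"] simp: unit_bound)
  finally show "0 \<le> ewor kv Q" .
qed

text \<open>Parseval for \<open>kv x\<close>, whose coefficients are the values of the
  eigenfunctions at \<open>x\<close>.\<close>

lemma kernel_diag_sums:
  assumes "x \<in> unit_cube"
  shows "(\<lambda>i. (eigfun (Suc i) x)\<^sup>2) sums K x x"
proof -
  have "(\<lambda>i. (inner (kv x) (eta (Suc i)))\<^sup>2) sums (norm (kv x))\<^sup>2"
  proof (rule Parseval)
    show "inner (eta (Suc i)) (eta (Suc j)) = (if i = j then 1 else 0)" for i j
      by (simp add: eta_orthonormal)
    fix \<epsilon> :: real assume "\<epsilon> > 0"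
    moreover have "kv x \<in> closure (span (eta ` {1..}))" using span_eta_dense by simp
    ultimately obtain h where h: "h \<in> span (eta ` {1..})" "dist h (kv x) < \<epsilon>"
      unfolding closure_approachable by blast
    obtain J c where J: "finite J" "J \<subseteq> {1..}" "h = (\<Sum>j\<in>J. c j *\<^sub>R eta j)"
      using span_eta_representation[OF h(1)] .
    \<comment> \<open>\<open>Parseval\<close> counts from 0 and the eigenpairs from 1, hence the
      shift of the index set.\<close>
    define I where "I = (\<lambda>j. j - 1) ` J"
    have pos: "1 \<le> j" if "j \<in> J" for j using J(2) that by auto
    then have Suc_pred: "Suc (j - Suc 0) = j" if "j \<in> J" for j using that by fastforce
    have "inj_on (\<lambda>j. j - 1) J"
    proof (rule inj_onI)
      fix i j assume "i \<in> J" "j \<in> J" "i - 1 = j - 1"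
      then show "i = j" using pos[of i] pos[of j] by linarith
    qed
    then have "(\<Sum>i\<in>I. c (Suc i) *\<^sub>R eta (Suc i)) = h"
      unfolding I_def J(3) by (subst sum.reindex) (auto intro!: sum.cong simp: Suc_pred)
    then have "norm (kv x - (\<Sum>i\<in>I. c (Suc i) *\<^sub>R eta (Suc i))) < \<epsilon>"
      using h(2) by (simp add: dist_norm norm_minus_commute)
    moreover have "finite I" using J(1) by (simp add: I_def)
    ultimately show "\<exists>J c. finite J \<and> norm (kv x - (\<Sum>j\<in>J. c j *\<^sub>R eta (Suc j))) < \<epsilon>"
      by (intro exI[of _ I] exI[of _ "\<lambda>i. c (Suc i)"] conjI)
  qed
  then show ?thesis
    by (simp add: rkhs_fun_def kernel_eq[OF assms assms] power2_norm_eq_inner inner_commute)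
qed

text \<open>The diagonal expansion is integrated term by term, and each squared eigenfunction has
  integral \<open>lam j\<close>.\<close>

lemma kernel_trace: "(\<integral>x. K x x \<partial>cube) = eig_tail lam 0"
proof -
  let ?g = "\<lambda>i x. (eigfun (Suc i) x)\<^sup>2"
  have int: "integrable cube (?g i)" for i
    by (rule sq_integrableD(2)[OF rkhs_sq_integrable])
  have eq: "(\<integral>x. ?g i x \<partial>cube) = lam (Suc i)" for i
    using eta_L2_orthogonal[of "Suc i" "Suc i"] by (simp add: L2_inner_def cube_int_def power2_eq_square)
  \<comment> \<open>Partial sums are bounded by the trace. Summability is what permits the
    interchange and gives the \<open>suminf\<close> in \<open>eig_tail\<close> its meaning.\<close>
  have "summable (\<lambda>i. lam (Suc i))"
  proof (rule summableI_nonneg_bounded[of _ "\<integral>x. K x x \<partial>cube"])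
    show "0 \<le> lam (Suc i)" for i using lam_pos[of "Suc i"] by simp
    have "(\<Sum>i<n. lam (Suc i)) = (\<integral>x. (\<Sum>i<n. ?g i x) \<partial>cube)" for n
      using int by (simp add: Bochner_Integration.integral_sum eq)
    also have "\<dots> n \<le> (\<integral>x. K x x \<partial>cube)" for n
    proof (rule integral_mono[OF _ kernel_diag_integrable])
      show "integrable cube (\<lambda>x. \<Sum>i<n. ?g i x)" using int by simp
      show "(\<Sum>i<n. ?g i x) \<le> K x x" if "x \<in> space cube" for x
        using kernel_diag_sums[of x] that
        by (metis sums_iff sum_le_suminf finite_lessThan zero_le_power2 space_lebesgue_on)
    qed
    finally show "(\<Sum>i<n. lam (Suc i)) \<le> (\<integral>x. K x x \<partial>cube)" for n .
  qed
  then have "(\<integral>x. (\<Sum>i. ?g i x) \<partial>cube) = (\<Sum>i. \<integral>x. ?g i x \<partial>cube)"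
    using kernel_diag_sums int by (intro integral_suminf) (auto simp: eq sums_iff intro!: AE_I2)
  moreover have "(\<integral>x. (\<Sum>i. ?g i x) \<partial>cube) = (\<integral>x. K x x \<partial>cube)"
    using kernel_diag_sums by (intro Bochner_Integration.integral_cong) (auto simp: sums_iff)
  ultimately show ?thesis by (simp add: eq eig_tail_def)
qed

text \<open>Starts the recursion: Fubini identifies this error with the trace, which the decay
  hypothesis at \<open>n = 0\<close> bounds by \<open>C\<close>.\<close>

lemma eavg_app_zero: "(eavg_app evb \<mu> (\<lambda>f x. 0))\<^sup>2 = eig_tail lam 0"
proof -
  have int: "integrable (cube \<Otimes>\<^sub>M \<mu>) (case_prod (\<lambda>x f. (evb f x)\<^sup>2))"
    using sq_integrableD(2)[OF evb_joint_sq_integrable] by (simp add: case_prod_unfold)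
  have "(eavg_app evb \<mu> (\<lambda>f x. 0))\<^sup>2 = (\<integral>f. (\<integral>x. (evb f x)\<^sup>2 \<partial>cube) \<partial>\<mu>)"
    by (simp add: eavg_app_def cube_int_def)
  also have "\<dots> = (\<integral>x. (\<integral>f. (evb f x)\<^sup>2 \<partial>\<mu>) \<partial>cube)"
    by (rule Fubini_integral[OF int])
  also have "\<dots> = (\<integral>x. K x x \<partial>cube)"
    by (intro Bochner_Integration.integral_cong) (auto simp: covariance[symmetric] power2_eq_square)
  finally show ?thesis by (simp add: kernel_trace)
qed

section \<open>Positivity of the average-case error\<close>

abbreviation xi :: "nat \<Rightarrow> real^'d \<Rightarrow> real" where
  "xi \<equiv> xi_fun kv lam eta"

lemma xi_sq_integrable: "sq_integrable cube (xi j)"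
  using sq_integrable_cmult[OF rkhs_sq_integrable, of "1 / sqrt (lam j)" "eta j"]
  by (simp add: xi_fun_def[abs_def])

text \<open>The output of the algorithm is orthogonal to \<open>\<eta>\<^sub>M\<^sub>+\<^sub>1\<close>, so the error is at least that of
  approximating the component along \<open>\<eta>\<^sub>M\<^sub>+\<^sub>1\<close> by zero. (If the error could vanish, the
  quotient in the choice of \<open>m\<^sub>k\<close> would take the junk value zero.)\<close>

lemma eavg_app_pos:
  assumes A: "point_algorithm xi S M A" and S: "finite S" "S \<subseteq> unit_cube"
  shows "eavg_app evb \<mu> A > 0"
proof -
  obtain \<phi> where \<phi>: "\<And>j. point_functional S (\<phi> j)" "\<And>f x. A f x = (\<Sum>j=1..M. \<phi> j f * xi j x)"
    using A unfolding point_algorithm_def by blast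
  have \<phi>_sq: "sq_integrable \<mu> (\<lambda>f. \<phi> j (evb f))" for j
  proof -
    obtain w where w: "\<And>f. \<phi> j f = (\<Sum>t\<in>S. w t * f t)"
      using \<phi>(1)[of j] unfolding point_functional_def by blast
    show ?thesis
      unfolding w using S(2) by (intro sq_integrable_sum sq_integrable_cmult evb_point_sq_integrable) auto
  qed
  define G where "G x f = evb f x - A (evb f) x" for x f
  \<comment> \<open>The lower bound needs an integrable squared residual norm, since a
    non-integrable one would have Bochner integral 0.\<close>
  have "sq_integrable (cube \<Otimes>\<^sub>M \<mu>) (\<lambda>z. (case z of (x, f) \<Rightarrow> evb f x)
      - (\<Sum>j=1..M. case z of (x, f) \<Rightarrow> xi j x * \<phi> j (evb f)))"
    by (intro sq_integrable_diff sq_integrable_sum sq_integrable_tensor evb_joint_sq_integrable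
        xi_sq_integrable \<phi>_sq)
  then have "sq_integrable (cube \<Otimes>\<^sub>M \<mu>) (case_prod G)"
    by (simp add: G_def[abs_def] \<phi>(2) case_prod_unfold mult.commute)
  then have "integrable (cube \<Otimes>\<^sub>M \<mu>) (case_prod (\<lambda>x f. (G x f)\<^sup>2))"
    by (simp add: sq_integrable_def case_prod_unfold)
  then have int: "integrable \<mu> (\<lambda>f. \<integral>x. (G x f)\<^sup>2 \<partial>cube)"
    by (rule integrable_snd)
  have G_sq: "sq_integrable cube (\<lambda>x. G x f)" for f
    unfolding G_def \<phi>(2)
    by (intro sq_integrable_diff sq_integrable_sum sq_integrable_cmult evb_sq_integrable xi_sq_integrable)
  define n where "n = Suc M"
  have n: "n \<ge> 1" by (simp add: n_def)
  have orth: "(\<integral>x. eigfun n x * xi j x \<partial>cube) = 0" if "j \<in> {1..M}" for j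
    using that eta_L2_orthogonal[OF n, of j]
    by (auto simp: xi_fun_def L2_inner_def cube_int_def n_def)
  have coef_G: "coef n f = (\<integral>x. eigfun n x * G x f \<partial>cube)" for f
  proof -
    have "(\<integral>x. eigfun n x * G x f \<partial>cube)
        = (\<integral>x. eigfun n x * evb f x - (\<Sum>j=1..M. \<phi> j (evb f) * (eigfun n x * xi j x)) \<partial>cube)"
      by (simp add: G_def \<phi>(2) right_diff_distrib sum_distrib_left mult.left_commute)
    also have "\<dots> = coef n f - (\<Sum>j=1..M. \<phi> j (evb f) * (\<integral>x. eigfun n x * xi j x \<partial>cube))"
      using sq_integrable_mult[OF rkhs_sq_integrable evb_sq_integrable]
        sq_integrable_mult[OF rkhs_sq_integrable xi_sq_integrable]
      by (subst Bochner_Integration.integral_diff) (auto simp: coef_def Bochner_Integration.integral_sum)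
    finally show ?thesis by (simp add: orth)
  qed
  have norm_n: "(\<integral>x. (eigfun n x)\<^sup>2 \<partial>cube) = lam n"
    using eta_L2_orthogonal[OF n n] by (simp add: L2_inner_def cube_int_def power2_eq_square)
  \<comment> \<open>Cauchy-Schwarz bounds the second moment \<open>(lam n)\<^sup>2\<close> by
    \<open>lam n\<close> times the squared error, so the latter is at least
    \<open>lam n\<close>.\<close>
  have "(lam n)\<^sup>2 = (\<integral>f. (coef n f)\<^sup>2 \<partial>\<mu>)"
    using expectation_coef_coef[OF n n] by (simp add: power2_eq_square)
  also have "\<dots> \<le> (\<integral>f. lam n * (\<integral>x. (G x f)\<^sup>2 \<partial>cube) \<partial>\<mu>)"
    using int Cauchy_Schwarz_integral[OF rkhs_sq_integrable G_sq, of "eta n"]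
    by (intro integral_mono sq_integrableD(2)[OF coef_sq_integrable]) (auto simp: coef_G norm_n)
  also have "\<dots> = lam n * (\<integral>f. \<integral>x. (G x f)\<^sup>2 \<partial>cube \<partial>\<mu>)" by simp
  finally have "(\<integral>f. \<integral>x. (G x f)\<^sup>2 \<partial>cube \<partial>\<mu>) > 0"
    using lam_pos[OF n] by (smt (verit) mult_nonneg_nonpos zero_less_power)
  then show ?thesis by (simp add: eavg_app_def cube_int_def G_def)
qed

end

section \<open>The cubature rule\<close>

theorem theorem5p8:
  fixes K :: "real^'d \<Rightarrow> real^'d \<Rightarrow> real"
    and kv :: "real^'d \<Rightarrow> 'h::{real_inner,complete_space}"
    and lam :: "nat \<Rightarrow> real" and eta :: "nat \<Rightarrow> 'h"
    and evb :: "'b::banach \<Rightarrow> real^'d \<Rightarrow> real" and \<mu> :: "'b measure"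
    and C p :: real and N :: nat
    and P :: "nat \<Rightarrow> nat \<Rightarrow> real^'d" and T :: "nat \<Rightarrow> real^'d"
  defines "A \<equiv> constr_A kv lam eta evb \<mu> C p P"
      and "m \<equiv> constr_m kv lam eta evb \<mu> C p P"
      and "Q \<equiv> constr_Q kv lam eta evb \<mu> C p P N T"
  assumes H: "rkhs_setting K kv lam eta"
    and B: "banach_setting K kv evb \<mu>"
    and Cpos: "C > 0" and ppos: "p > 0"
    and decay: "\<forall>n. eig_tail lam n \<le> C * real (n + 1) powr (- p)"
    and N2: "N \<ge> 2"
    and Pk: "\<forall>k. K_p p < k \<and> k \<le> kappa N \<longrightarrow>
               (\<forall>l < 2 ^ (k - 1). P k l \<in> unit_cube) \<and>
               (eavg_app evb \<mu> (A k))\<^sup>2 \<le> eig_tail lam (m (k - 1))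
                  + real (m (k - 1)) / 2 ^ (k - 1) * (eavg_app evb \<mu> (A (k - 1)))\<^sup>2"
    and Tint: "(\<forall>l < 2 ^ kappa N. T l \<in> unit_cube) \<and>
               (eavg_int evb \<mu> Q)\<^sup>2 \<le> 1 / 2 ^ kappa N * (eavg_app evb \<mu> (A (kappa N)))\<^sup>2"
  shows "(\<exists>S w. finite S \<and> S \<subseteq> unit_cube \<and> card S \<le> N \<and>
            (\<forall>f. Q f = (\<Sum>t\<in>S. w t * f t)))
       \<and> (ewor kv Q)\<^sup>2 \<le> 2 powr ((p + 2) * (p + 1)) * (1 + p) * (1 + 1 / p) powr p * C
                          * (1 / real N powr (p + 1))"
proof -
  interpret rkhs_gaussian K kv lam eta evb \<mu>
    by unfold_locales (rule H, rule B)
  define \<kappa> where "\<kappa> = kappa N"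
  have A_seq: "A k = alg_seq xi (eavg_app evb \<mu>) C p P k" for k
    by (simp add: A_def constr_A_def)
  have alg: "\<exists>S M. finite S \<and> S \<subseteq> unit_cube \<and> card S < 2 ^ k \<and> point_algorithm xi S M (A k)"
    if "k \<le> \<kappa>" for k
    unfolding A_seq
  proof (rule point_algorithm_alg_seq)
    show "integrable (lebesgue_on unit_cube) (\<lambda>x. xi i x * xi j x)" for i j
      by (rule sq_integrable_mult[OF xi_sq_integrable xi_sq_integrable])
    show "P i l \<in> unit_cube" if "K_p p < i" "i \<le> k" "l < 2 ^ (i - 1)" for i l
      using Pk that \<open>k \<le> \<kappa>\<close> unfolding \<kappa>_def by (meson order_trans)
  qed
  obtain S M where S: "finite S" "S \<subseteq> unit_cube" "card S < 2 ^ \<kappa>" "point_algorithm xi S M (A \<kappa>)"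
    using alg[of \<kappa>] by auto
  define S' where "S' = S \<union> T ` {..<2 ^ \<kappa>}"
  have Q: "Q = cub_step (A \<kappa>) (2 ^ \<kappa>) T"
    by (simp add: Q_def constr_Q_def A_def \<kappa>_def)
  have xi_int: "integrable (lebesgue_on unit_cube) (xi j)" for j
    using sq_integrable_mult[OF xi_sq_integrable cube.sq_integrable_const, of j 1] by simp
  obtain w where w: "\<And>f. Q f = (\<Sum>t\<in>S'. w t * f t)"
    using point_functional_cub_step[OF S(4,1) xi_int, of T "2 ^ \<kappa>"]
    unfolding Q[symmetric] S'_def[symmetric] point_functional_def by blast
  \<comment> \<open>Fewer than \<open>2 ^ \<kappa>\<close> nodes of the algorithm and at most
    \<open>2 ^ \<kappa>\<close> of the correction give at most
    \<open>2 ^ (\<kappa> + 1) \<le> N\<close>.\<close>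
  have "card S' \<le> card S + card (T ` {..<2 ^ \<kappa> :: nat})"
    unfolding S'_def by (rule card_Un_le)
  also have "\<dots> \<le> card S + 2 ^ \<kappa>"
    using card_image_le[of "{..<2 ^ \<kappa> :: nat}" T] by simp
  also have "\<dots> \<le> N"
    using S(3) kappa_bounds(1)[OF N2] by (simp add: \<kappa>_def)
  finally have S': "finite S'" "S' \<subseteq> unit_cube" "card S' \<le> N"
    using S Tint by (auto simp: S'_def \<kappa>_def)
  have "(ewor kv Q)\<^sup>2 \<le> (eavg_int evb \<mu> Q)\<^sup>2"
    by (intro power_mono ewor_le_eavg_int[OF S'(1,2) w])
  also have "\<dots> \<le> 1 / 2 ^ \<kappa> * (eavg_app evb \<mu> (A \<kappa>))\<^sup>2"
    using Tint by (simp add: \<kappa>_def)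
  also have "\<dots> \<le> 1 / 2 ^ \<kappa> *
      (C * (2 powr p * omega_fn p (y_p p)) powr (p + 1) * 2 powr (- real \<kappa> * p))"
  proof (intro mult_left_mono error_recursion[where tail = "eig_tail lam"])
    have pos: "eavg_app evb \<mu> (A k) > 0" if "k \<le> \<kappa>" for k
      using alg[OF that] eavg_app_pos by blast
    show "(eavg_app evb \<mu> (A k))\<^sup>2 > 0" if "k \<le> \<kappa>" for k
      using pos[OF that] by simp
    show "(eavg_app evb \<mu> (A k))\<^sup>2 \<le> C" if "k \<le> K_p p" for k
    proof -
      have "A k = (\<lambda>f x. 0)"
        using that unfolding A_seq by (cases k) auto
      then show ?thesis using eavg_app_zero spec[OF decay, of 0] by simp
    qed
    fix k assume k: "K_p p \<le> k" "k < \<kappa>"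
    \<comment> \<open>The recursion works with squared errors; positivity recovers the error itself,
      which is the argument in \<open>constr_m\<close>.\<close>
    have "m_choice C p k (sqrt ((eavg_app evb \<mu> (A k))\<^sup>2)) = m k"
      using pos[of k] k(2) by (simp add: m_def constr_m_def A_def)
    then show "(eavg_app evb \<mu> (A (Suc k)))\<^sup>2
      \<le> eig_tail lam (m_choice C p k (sqrt ((eavg_app evb \<mu> (A k))\<^sup>2)))
        + real (m_choice C p k (sqrt ((eavg_app evb \<mu> (A k))\<^sup>2))) / 2 ^ k * (eavg_app evb \<mu> (A k))\<^sup>2"
      using Pk[rule_format, of "Suc k"] k by (simp add: \<kappa>_def)
  qed (use ppos Cpos decay in auto)
  also have "\<dots> \<le> 2 powr ((p + 2) * (p + 1)) * (1 + p) * (1 + 1 / p) powr p * C * (1 / real N powr (p + 1))"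
    unfolding \<kappa>_def by (rule final_constant[OF ppos Cpos N2])
  finally show ?thesis using S' w by blast
qed

end
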